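(* Let $n\ge 1$ and let $D\subset\mathbb{C}^n$ be a bounded, balanced and convex domain. Then $m_D(0)=1$, where $m_D=s_D/e_D$ is the quotient of the squeezing function by the Fridman invariant of $D$.
   Context: A domain is a nonempty connected open set. A domain $D\subset\mathbb{C}^n$ is balanced if for every $z\in D$ one has $\lambda z\in D$ for all $\lambda\in\mathbb{C}$ with $|\lambda|\le 1$. $\mathbb{B}^n$ is the open Euclidean unit ball in $\mathbb{C}^n$ centered at $0$, and $r\mathbb{B}^n$ is the ball of radius $r$. For domains $D_1,D_2\subset\mathbb{C}^n$, $\mathcal{O}_u(D_1,D_2)$ is the set of injective holomorphic maps $D_1\to D_2$. $k_D$ is the Kobayashi (pseudo)distance on $D$, normalized so that on the unit disk $\Delta\subset\mathbb{C}$ one has $k_\Delta(0,z)=\operatorname{artanh}|z|$: $k_D(z,w)$ is the infimum of $\sum_{j=1}^N k_\Delta(a_j,b_j)$ over all chains of holomorphic maps $f_j:\Delta\to D$ with $f_1(a_1)=z$, $f_j(b_j)=f_{j+1}(a_{j+1})$, $f_N(b_N)=w$. For $z\in D$, $r>0$, let $B_D^k(z,r)=\{w\in D: k_D(z,w)<r\}$. For a bounded domain $D\subset\mathbb{C}^n$ and $z\in D$, the Fridman invariant is $$e_D(z)=\sup\{\tanh(r): r>0,\ B_D^k(z,r)\subset f(\mathbb{B}^n) \text{ for some } f\in\mathcal{O}_u(\mathbb{B}^n,D) \text{ with } f(0)=z\},$$ the squeezing function is $$s_D(z)=\sup\{r>0: r\mathbb{B}^n\subset f(D) \text{ for some } f\in\mathcal{O}_u(D,\mathbb{B}^n)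 \text{ with } f(z)=0\},$$ both take values in $(0,1]$, and $m_D(z)=s_D(z)/e_D(z)$. *)

theory Defs
  imports "HOL-Complex_Analysis.Complex_Analysis"
begin

definition is_domain :: "(complex ^ 'n) set \<Rightarrow> bool" where
  "is_domain D \<longleftrightarrow> D \<noteq> {} \<and> connected D \<and> open D"

definition balanced :: "(complex ^ 'n) set \<Rightarrow> bool" where
  "balanced D \<longleftrightarrow> (\<forall>z\<in>D. \<forall>c::complex. norm c \<le> 1 \<longrightarrow> c *s z \<in> D)"

text \<open>
  The norm on \<open>complex ^ 'n\<close> is the Euclidean (Hermitian) one, so \<open>ball 0 r\<close> is the ball
  of radius \<open>r\<close> in the complex space of dimension \<open>CARD('n)\<close>. The notion below is only
  used for open \<open>D\<close>, where it is the usual one. The derivative \<open>f'\<close> below is real linear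
  by \<open>has_derivative\<close>; the last conjunct makes it complex linear.
\<close>

definition holomorphic_map_on :: "(complex ^ 'n \<Rightarrow> complex ^ 'm) \<Rightarrow> (complex ^ 'n) set \<Rightarrow> bool" where
  "holomorphic_map_on f D \<longleftrightarrow>
     (\<forall>z\<in>D. \<exists>f'. (f has_derivative f') (at z within D) \<and> (\<forall>(c::complex) v. f' (c *s v) = c *s f' v))"

text \<open>Values outside \<open>D1\<close> are arbitrary, as usual for total functions.\<close>

definition inj_holomorphic_maps ::
  "(complex ^ 'n) set \<Rightarrow> (complex ^ 'n) set \<Rightarrow> (complex ^ 'n \<Rightarrow> complex ^ 'n) set" where
  "inj_holomorphic_maps D1 D2 = {f. holomorphic_map_on f D1 \<and> inj_on f D1 \<and> f ` D1 \<subseteq> D2}"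

definition holomorphic_disc_in :: "(complex \<Rightarrow> complex ^ 'n) \<Rightarrow> (complex ^ 'n) set \<Rightarrow> bool" where
  "holomorphic_disc_in f D \<longleftrightarrow>
     (\<forall>i. (\<lambda>\<zeta>. f \<zeta> $ i) holomorphic_on ball 0 1) \<and> f ` ball 0 1 \<subseteq> D"

text \<open>The Poincare distance of the unit disc, normalized by \<open>poincare_dist 0 z = artanh (norm z)\<close>.\<close>

definition poincare_dist :: "complex \<Rightarrow> complex \<Rightarrow> real" where
  "poincare_dist a b = artanh (norm ((a - b) / (1 - cnj b * a)))"

text \<open>
  For a domain \<open>D\<close> and \<open>z, w \<in> D\<close> the set of chain lengths below is nonempty and bounded below
  by 0, so the infimum in the reals is the intended one.
\<close>

definition kobayashi_dist :: "(complex ^ 'n) set \<Rightarrow> complex ^ 'n \<Rightarrow> complex ^ 'n \<Rightarrow> real" where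
  "kobayashi_dist D z w = Inf {(\<Sum>j=1..N. poincare_dist (a j) (b j)) | (N::nat) a b f.
     N \<ge> 1 \<and>
     (\<forall>j\<in>{1..N}. a j \<in> ball 0 1 \<and> b j \<in> ball 0 1 \<and> holomorphic_disc_in (f j) D) \<and>
     f 1 (a 1) = z \<and> (\<forall>j\<in>{1..<N}. f j (b j) = f (j + 1) (a (j + 1))) \<and> f N (b N) = w}"

definition kobayashi_ball :: "(complex ^ 'n) set \<Rightarrow> complex ^ 'n \<Rightarrow> real \<Rightarrow> (complex ^ 'n) set" where
  "kobayashi_ball D z r = {w \<in> D. kobayashi_dist D z w < r}"

text \<open>
  For a bounded domain \<open>D\<close> and \<open>z \<in> D\<close> the sets in the next two definitions are nonempty and
  bounded above by 1, so both suprema are genuine.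
\<close>

definition fridman_invariant :: "(complex ^ 'n) set \<Rightarrow> complex ^ 'n \<Rightarrow> real" where
  "fridman_invariant D z = Sup {tanh r | r. r > 0 \<and>
     (\<exists>f \<in> inj_holomorphic_maps (ball 0 1) D. f 0 = z \<and> kobayashi_ball D z r \<subseteq> f ` ball 0 1)}"

definition squeezing_function :: "(complex ^ 'n) set \<Rightarrow> complex ^ 'n \<Rightarrow> real" where
  "squeezing_function D z = Sup {r. r > 0 \<and>
     (\<exists>f \<in> inj_holomorphic_maps D (ball 0 1). f z = 0 \<and> ball 0 r \<subseteq> f ` D)}"

definition squeezing_fridman_quotient :: "(complex ^ 'n) set \<Rightarrow> complex ^ 'n \<Rightarrow> real" where
  "squeezing_fridman_quotient D z = squeezing_function D z / fridman_invariant D z"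

end

theory Submission
  imports Defs
begin

text \<open>
  Fix a holomorphic injection \<open>f : U \<rightarrow> W\<close> with \<open>f 0 = 0\<close> and \<open>V \<subseteq> f(U)\<close>, where \<open>U\<close>, \<open>V\<close>, \<open>W\<close> are open,
  balanced and convex and \<open>U\<close> is bounded, and let \<open>L = f'(0)\<close>. The Schwarz lemma for \<open>f\<close> gives
  \<open>L(U) \<subseteq> W\<close>, the Schwarz lemma for \<open>f\<^sup>-\<^sup>1\<close> gives \<open>V \<subseteq> L(U)\<close>. So both suprema may be taken over
  linear maps, and since the Kobayashi ball of radius \<open>r\<close> around \<open>0\<close> in \<open>D\<close> is \<open>tanh r \<cdot> D\<close>, the map
  \<open>A \<mapsto> \<rho> A\<^sup>-\<^sup>1\<close> exchanges the two extremal problems.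

  The holomorphy of \<open>f\<^sup>-\<^sup>1\<close> (Osgood's theorem) is avoided: \<open>f\<^sup>-\<^sup>1\<close> is continuous by invariance of domain
  and differentiable at regular values, which are dense by Sard's theorem. With \<open>k\<close> the Jacobian
  determinant of \<open>f\<close> at \<open>f\<^sup>-\<^sup>1\<close>, the maximum principle for \<open>G\<^sup>n k\<close> with \<open>n \<rightarrow> \<infinity>\<close>, where \<open>G\<close> is the
  Schwarz quotient of \<open>f\<^sup>-\<^sup>1\<close> on a disc, replaces the one for \<open>G\<close>.
\<close>

section \<open>The Poincare distance and a maximum principle\<close>

lemma artanh_real_le_iff:
  fixes x y :: real
  assumes "\<bar>x\<bar> < 1" "\<bar>y\<bar> < 1"
  shows "artanh x \<le> artanh y \<longleftrightarrow> x \<le> y"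
proof -
  have "artanh x \<le> artanh y \<longleftrightarrow> (1 + x) / (1 - x) \<le> (1 + y) / (1 - y)"
    using assms by (auto simp: artanh_def abs_less_iff)
  also have "\<dots> \<longleftrightarrow> x \<le> y"
    using assms by (auto simp: field_simps abs_less_iff)
  finally show ?thesis .
qed

lemma artanh_real_diff:
  fixes p q :: real
  assumes "\<bar>p\<bar> < 1" "\<bar>q\<bar> < 1"
  shows "artanh ((q - p) / (1 - p * q)) = artanh q - artanh p"
proof -
  have pq: "p * q < 1"
    using abs_mult_less[OF assms] by (simp add: abs_mult[symmetric] abs_less_iff)
  have pos: "0 < 1 + p" "0 < 1 - p" "0 < 1 + q" "0 < 1 - q"
    using assms by (auto simp: abs_less_iff)
  have "1 + (q - p) / (1 - p * q) = (1 + q) * (1 - p) / (1 - p * q)"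
    using pq by (simp add: field_simps)
  moreover have "1 - (q - p) / (1 - p * q) = (1 - q) * (1 + p) / (1 - p * q)"
    using pq by (simp add: field_simps)
  ultimately have "(1 + (q - p) / (1 - p * q)) / (1 - (q - p) / (1 - p * q)) =
      ((1 + q) / (1 - q)) / ((1 + p) / (1 - p))"
    using pq pos by simp
  then show ?thesis
    using pos by (simp add: artanh_def ln_div ln_mult) argo
qed

lemma poincare_dist_nonneg:
  assumes "norm a < 1" "norm b < 1"
  shows "0 \<le> poincare_dist a b"
proof -
  have "norm ((a - b) / (1 - cnj b * a)) < 1"
    using Moebius_function_norm_lt_1[OF assms(2,1), of 0] by (simp add: Moebius_function_simple)
  then show ?thesis
    using artanh_real_le_iff[of 0 "norm ((a - b) / (1 - cnj b * a))"]
    by (simp add: poincare_dist_def)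
qed

text \<open>Besides the moduli of \<open>p\<close> and \<open>q\<close>, only
  \<open>norm (1 - cnj q * p)\<close> enters the right-hand side, so the Poincare distance can be
  minimised over all positions with given moduli.\<close>

lemma one_minus_norm_Moebius_sq:
  assumes "norm p < 1" "norm q < 1"
  shows "1 - (norm ((p - q) / (1 - cnj q * p)))\<^sup>2 =
    (1 - (norm p)\<^sup>2) * (1 - (norm q)\<^sup>2) / (norm (1 - cnj q * p))\<^sup>2"
proof -
  have nz: "1 - cnj q * p \<noteq> 0"
    using assms by (metis complex_mod_cnj less_irrefl norm_mult_less norm_one right_minus_eq mult_1)
  have "(norm (1 - cnj q * p))\<^sup>2 - (norm (p - q))\<^sup>2 = (1 - (norm p)\<^sup>2) * (1 - (norm q)\<^sup>2)"
    by (cases p; cases q) (simp only: cmod_power2, simp add: algebra_simps power2_eq_square)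
  then show ?thesis
    using nz by (simp add: norm_divide power_divide field_simps)
qed

text \<open>With the moduli of \<open>p\<close> and \<open>q\<close> fixed,
  \<open>norm (1 - cnj q * p)\<close> is at least \<open>1 - norm p * norm q\<close>, so the points
  can be no closer than if they lay on one ray. In that position the distance is
  \<open>artanh y\<close>, the difference of the two distances from 0.\<close>

lemma poincare_dist_triangle_0:
  assumes "norm p < 1" "norm q < 1"
  shows "artanh (norm q) \<le> artanh (norm p) + poincare_dist p q"
proof (cases "norm q \<le> norm p")
  case True
  then show ?thesis
    using artanh_real_le_iff[of "norm q" "norm p"] poincare_dist_nonneg[OF assms] assms by simp
next
  case False
  define x where "x = norm ((p - q) / (1 - cnj q * p))"
  define y where "y = (norm q - norm p) / (1 - norm p * norm q)"
  have x: "0 \<le> x" "x < 1"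
    using Moebius_function_norm_lt_1[OF assms(2,1), of 0] by (simp_all add: x_def Moebius_function_simple)
  have pq: "norm p * norm q < 1"
    using abs_mult_less[of "norm p" 1 "norm q" 1] assms by simp
  have "1 - x\<^sup>2 = (1 - (norm p)\<^sup>2) * (1 - (norm q)\<^sup>2) / (norm (1 - cnj q * p))\<^sup>2"
    unfolding x_def by (rule one_minus_norm_Moebius_sq[OF assms])
  also have "\<dots> \<le> (1 - (norm p)\<^sup>2) * (1 - (norm q)\<^sup>2) / (1 - norm p * norm q)\<^sup>2"
  proof (rule divide_left_mono)
    have "1 - norm p * norm q \<le> norm (1 - cnj q * p)"
      using norm_triangle_ineq2[of 1 "cnj q * p"] by (simp add: norm_mult mult.commute)
    then show "(1 - norm p * norm q)\<^sup>2 \<le> (norm (1 - cnj q * p))\<^sup>2"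
      and "0 < (norm (1 - cnj q * p))\<^sup>2 * (1 - norm p * norm q)\<^sup>2"
      using pq by (auto intro!: power_mono mult_pos_pos zero_less_power)
    show "0 \<le> (1 - (norm p)\<^sup>2) * (1 - (norm q)\<^sup>2)"
      using assms by (auto intro!: mult_nonneg_nonneg simp: power_le_one)
  qed
  also have "\<dots> = 1 - y\<^sup>2"
  proof -
    have "(1 - norm p * norm q)\<^sup>2 - (norm q - norm p)\<^sup>2 = (1 - (norm p)\<^sup>2) * (1 - (norm q)\<^sup>2)"
      by (simp add: algebra_simps power2_eq_square)
    moreover have "1 - y\<^sup>2 = ((1 - norm p * norm q)\<^sup>2 - (norm q - norm p)\<^sup>2) / (1 - norm p * norm q)\<^sup>2"
      using pq by (simp only: y_def power_divide) (simp add: diff_divide_distrib)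
    ultimately show ?thesis by simp
  qed
  finally have "y\<^sup>2 \<le> x\<^sup>2" by simp
  then have yx: "y \<le> x"
    using x power2_le_imp_le by blast
  moreover have "0 \<le> y"
    using False pq by (simp add: y_def)
  ultimately have "artanh y \<le> artanh x"
    using x artanh_real_le_iff by simp
  then show ?thesis
    using artanh_real_diff[of "norm p" "norm q"] assms
    by (simp add: y_def x_def poincare_dist_def)
qed

text \<open>Moebius maps moving \<open>b\<close> and \<open>F b\<close> to 0 turn \<open>F\<close>
  into a self-map \<open>H\<close> of the disc that fixes 0; the Schwarz lemma for \<open>H\<close>
  at the point corresponding to \<open>a\<close> is the claim.\<close>

lemma poincare_dist_Schwarz_Pick:
  assumes holF: "F holomorphic_on ball 0 1" and F: "F ` ball 0 1 \<subseteq> ball 0 1"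
    and a: "norm a < 1" and b: "norm b < 1"
  shows "poincare_dist (F a) (F b) \<le> poincare_dist a b"
proof -
  define H where "H = Moebius_function 0 (F b) \<circ> (F \<circ> Moebius_function 0 (- b))"
  define \<zeta> where "\<zeta> = Moebius_function 0 b a"
  have FB: "norm (F z) < 1" if "norm z < 1" for z
    using F that by (auto simp: image_subset_iff)
  have \<zeta>: "norm \<zeta> < 1"
    unfolding \<zeta>_def by (rule Moebius_function_norm_lt_1[OF b a])
  have mb: "Moebius_function 0 (- b) ` ball 0 1 \<subseteq> ball 0 1"
    using Moebius_function_norm_lt_1[of "- b"] b by (auto simp: image_subset_iff)
  have "H holomorphic_on ball 0 1"
    unfolding H_def
  proof (rule holomorphic_on_compose_gen[OF _ Moebius_function_holomorphic[OF FB[OF b]]])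
    show "F \<circ> Moebius_function 0 (- b) holomorphic_on ball 0 1"
      by (rule holomorphic_on_compose_gen[OF Moebius_function_holomorphic holF mb]) (simp add: b)
    show "(F \<circ> Moebius_function 0 (- b)) ` ball 0 1 \<subseteq> ball 0 1"
      using mb F by (auto simp: image_subset_iff)
  qed
  moreover have "H 0 = 0"
    by (simp add: H_def Moebius_function_of_zero Moebius_function_eq_zero)
  moreover have "norm (H z) < 1" if "norm z < 1" for z
    unfolding H_def o_def
    by (intro Moebius_function_norm_lt_1 FB) (simp_all add: b that)
  ultimately have "norm (H \<zeta>) \<le> norm \<zeta>"
    using Schwarz_Lemma(1) \<zeta> by blast
  moreover have "H \<zeta> = Moebius_function 0 (F b) (F a)"
    by (simp add: H_def \<zeta>_def Moebius_function_compose a b)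
  ultimately have "norm (Moebius_function 0 (F b) (F a)) \<le> norm (Moebius_function 0 b a)"
    by (simp add: \<zeta>_def)
  moreover have "norm (Moebius_function 0 b a) < 1"
    by (rule Moebius_function_norm_lt_1[OF b a])
  ultimately show ?thesis
    unfolding poincare_dist_def Moebius_function_simple
    by (subst artanh_real_le_iff) auto
qed

text \<open>A frontier point of the set \<open>S\<close> where \<open>k\<close> does not vanish
  either lies on the circle, where \<open>G\<close> is bounded by \<open>M\<close>, or is a zero of
  \<open>k\<close>, where \<open>G z ^ n * k z\<close> vanishes however large \<open>G\<close> is.
  The maximum principle therefore bounds the product, and letting \<open>n\<close> grow removes the
  factor \<open>k\<close>.\<close>

lemma norm_le_max_where_nonzero:
  fixes G k :: "complex \<Rightarrow> complex"
  assumes contG: "continuous_on (cball 0 R) G" and contk: "continuous_on (cball 0 R) k"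
    and holG: "G holomorphic_on {z \<in> ball 0 R. k z \<noteq> 0}"
    and holk: "k holomorphic_on {z \<in> ball 0 R. k z \<noteq> 0}"
    and M: "\<And>z. norm z = R \<Longrightarrow> norm (G z) \<le> M"
    and \<alpha>: "norm \<alpha> < R" "k \<alpha> \<noteq> 0"
  shows "norm (G \<alpha>) \<le> M"
proof (rule ccontr)
  assume less: "\<not> norm (G \<alpha>) \<le> M"
  define S where "S = {z \<in> ball 0 R. k z \<noteq> 0}"
  have R: "0 < R"
    using \<alpha>(1) norm_ge_zero[of \<alpha>] by linarith
  have "0 \<le> M"
    using M[of "of_real R"] R order_trans[OF norm_ge_zero] by simp
  have "bounded (k ` cball 0 R)"
    by (intro compact_imp_bounded compact_continuous_image contk compact_cball)
  then obtain K where K: "\<And>z. z \<in> cball 0 R \<Longrightarrow> norm (k z) \<le> K"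
    unfolding bounded_iff by blast
  have "S = ball 0 R \<inter> k -` (- {0})"
    by (auto simp: S_def)
  then have openS: "open S"
    using continuous_open_preimage[OF continuous_on_subset[OF contk ball_subset_cball], of "- {0}"]
    by (simp add: open_Compl)
  have clS: "closure S \<subseteq> cball 0 R"
    by (rule closure_minimal) (auto simp: S_def)
  have fr: "norm z = R \<or> k z = 0" "norm z \<le> R" if "z \<in> frontier S" for z
  proof -
    have "z \<in> cball 0 R" "z \<notin> S"
      using that clS openS by (auto simp: frontier_def interior_open)
    then show "norm z = R \<or> k z = 0" "norm z \<le> R"
      by (auto simp: S_def)
  qed
  have bound: "norm (G \<alpha>) ^ n * norm (k \<alpha>) \<le> M ^ n * K" if "0 < n" for n
  proof -
    have "norm (G \<alpha> ^ n * k \<alpha>) \<le> M ^ n * K"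
    proof (rule maximum_modulus_frontier[of "\<lambda>z. G z ^ n * k z" S])
      show "(\<lambda>z. G z ^ n * k z) holomorphic_on interior S"
        using holG holk openS by (auto simp: S_def interior_open intro!: holomorphic_intros)
      show "continuous_on (closure S) (\<lambda>z. G z ^ n * k z)"
        by (intro continuous_intros continuous_on_subset[OF contG] continuous_on_subset[OF contk] clS)
      show "bounded S"
        by (rule bounded_subset[OF bounded_ball[of 0 R]]) (auto simp: S_def)
      show "\<alpha> \<in> S"
        using \<alpha> by (simp add: S_def)
      show "norm (G z ^ n * k z) \<le> M ^ n * K" if z: "z \<in> frontier S" for z
      proof (cases "k z = 0")
        case True
        have "0 \<le> K"
          using K[of 0] R order_trans[OF norm_ge_zero] by simp
        then show ?thesis
          using True \<open>0 \<le> M\<close> by simp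
      next
        case False
        then have "norm z = R"
          using fr[OF z] by simp
        then show ?thesis
          using M[of z] K[of z] zero_le_power[OF \<open>0 \<le> M\<close>, of n]
          by (auto simp: norm_mult norm_power intro!: mult_mono power_mono)
      qed
    qed
    then show ?thesis
      by (simp add: norm_mult norm_power)
  qed
  have pos: "0 < norm (G \<alpha>)"
    using less \<open>0 \<le> M\<close> by linarith
  \<comment> \<open>If \<open>norm (G \<alpha>)\<close> exceeded \<open>M\<close>, dividing
    \<open>bound\<close> by its n-th power would force \<open>k \<alpha>\<close> to be 0.\<close>
  define q where "q = M / norm (G \<alpha>)"
  have q: "0 \<le> q" "q < 1"
    using less pos \<open>0 \<le> M\<close> by (auto simp: q_def)
  have "(\<lambda>n. q ^ n * K) \<longlonglongrightarrow> 0 * K"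
    by (intro tendsto_intros LIMSEQ_power_zero) (use q in auto)
  moreover have "norm (k \<alpha>) \<le> q ^ n * K" if "n \<ge> 1" for n
    using bound[of n] that pos by (simp add: q_def power_divide field_simps)
  ultimately have "norm (k \<alpha>) \<le> 0"
    by (intro Lim_bounded2[of "\<lambda>n. q ^ n * K" _ 1]) auto
  then show False
    using \<alpha>(2) by simp
qed

section \<open>Polars and Kobayashi balls of balanced convex domains\<close>

lemma of_real_vector_scalar_mult: "complex_of_real r *s x = r *\<^sub>R (x :: complex ^ 'n)"
  unfolding vec_eq_iff vector_smult_component vector_scaleR_component
  by (simp add: scaleR_conv_of_real)

lemma norm_vector_scalar_mult: "norm (c *s x) = norm c * norm (x :: complex ^ 'n)"
  by (simp add: norm_vec_def norm_mult L2_set_right_distrib)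

lemma balanced_scaleR:
  assumes "balanced D" "x \<in> D" "\<bar>r\<bar> \<le> 1"
  shows "r *\<^sub>R x \<in> D"
  using assms unfolding balanced_def
  by (metis of_real_vector_scalar_mult norm_of_real)

lemma balanced_zero: "balanced D \<Longrightarrow> D \<noteq> {} \<Longrightarrow> 0 \<in> D"
  using balanced_scaleR[of D _ 0] by auto

lemma balanced_ball: "balanced (ball 0 r)"
proof -
  have "norm (c *s z) < r" if "norm c \<le> 1" "norm z < r" for c :: complex and z :: "complex ^ 'n"
    using mult_mono[OF that(1) order_refl[of "norm z"]] that(2)
    by (simp add: norm_vector_scalar_mult)
  then show ?thesis by (auto simp: balanced_def)
qed

lemma scaleR_scalar_mult_commute: "c *s (r *\<^sub>R x) = r *\<^sub>R (c *s (x :: complex ^ 'n))"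
  by (simp flip: of_real_vector_scalar_mult)

lemma balanced_scaling:
  fixes D :: "(complex ^ 'n) set"
  assumes "balanced D"
  shows "balanced ((*\<^sub>R) r ` D)"
  using assms unfolding balanced_def by (auto simp: scaleR_scalar_mult_commute)

text \<open>Scaling is continuous, so an open set leaves room beyond each of its points. This slack
  makes bounds strict and absorbs passages to closures.\<close>

lemma open_scale_up:
  fixes x :: "'a::real_normed_vector"
  assumes "open D" "x \<in> D"
  obtains s where "1 < s" "s *\<^sub>R x \<in> D"
proof -
  have "((\<lambda>s. s *\<^sub>R x) \<longlongrightarrow> 1 *\<^sub>R x) (at_right 1)"
    by (intro tendsto_intros)
  then have "eventually (\<lambda>s. s *\<^sub>R x \<in> D) (at_right (1::real))"
    using assms topological_tendstoD by fastforce
  moreover have "eventually (\<lambda>s. 1 < s) (at_right (1::real))"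
    by (simp add: eventually_at_right_less)
  ultimately have "eventually (\<lambda>s. 1 < s \<and> s *\<^sub>R x \<in> D) (at_right (1::real))"
    using eventually_conj by blast
  then obtain s where "1 < s" "s *\<^sub>R x \<in> D"
    using eventually_happens trivial_limit_at_right_real by blast
  then show ?thesis by (rule that)
qed

text \<open>The counterpart of \<open>open_scale_up\<close>: 0 is an interior point, so the segment
  from 0 to a point of the closure stays in the interior except possibly at its far end.\<close>

lemma scaleR_closure_in_open_convex:
  fixes D :: "'a::euclidean_space set"
  assumes "open D" "convex D" "0 \<in> D" "x \<in> closure D" "0 \<le> s" "s < 1"
  shows "s *\<^sub>R x \<in> D"
proof -
  have "x - (1 - s) *\<^sub>R (x - 0) \<in> interior D"
    by (rule mem_interior_closure_convex_shrink) (use assms in \<open>auto simp: interior_open\<close>)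
  then show ?thesis
    using assms(1) by (simp add: interior_open algebra_simps)
qed

text \<open>The bilinear rather than the Hermitian pairing: it is complex linear in
  \<open>x\<close>, so composing it with a holomorphic map preserves holomorphy.\<close>

definition cform :: "complex ^ 'n \<Rightarrow> complex ^ 'n \<Rightarrow> complex" where
  "cform c x = (\<Sum>i\<in>UNIV. c $ i * x $ i)"

lemma cform_add: "cform c (x + y) = cform c x + cform c y"
  by (simp add: cform_def sum.distrib algebra_simps)

lemma cform_diff: "cform c (x - y) = cform c x - cform c y"
  by (simp add: cform_def sum_subtractf algebra_simps)

lemma cform_scale: "cform c (a *s x) = a * cform c x"
  by (simp add: cform_def sum_distrib_left algebra_simps)

lemma cform_scaleR: "cform c (r *\<^sub>R x) = of_real r * cform c x"
  by (metis cform_scale of_real_vector_scalar_mult)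

lemma cform_zero [simp]: "cform c 0 = 0"
  by (simp add: cform_def)

lemma bounded_linear_cform: "bounded_linear (cform c)"
  by (rule linear_conv_bounded_linear[THEN iffD1])
    (auto intro!: linearI simp: cform_add cform_scaleR simp flip: scaleR_conv_of_real)

lemma holomorphic_on_cform:
  fixes f :: "complex \<Rightarrow> complex ^ 'n"
  assumes "\<And>i. (\<lambda>\<zeta>. f \<zeta> $ i) holomorphic_on S"
  shows "(\<lambda>\<zeta>. cform c (f \<zeta>)) holomorphic_on S"
  unfolding cform_def by (intro holomorphic_intros assms)

text \<open>The absolute polar. Through its functionals, maps into \<open>D\<close> become functions
  into the unit disc, to which the one-variable Schwarz lemma applies; by
  \<open>polar_separates\<close> they detect the closure of a balanced convex set.\<close>

definition polar :: "(complex ^ 'n) set \<Rightarrow> (complex ^ 'n) set" where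
  "polar D = {c. \<forall>x\<in>D. norm (cform c x) \<le> 1}"

lemma polar_strict:
  assumes "open D" "c \<in> polar D" "x \<in> D"
  shows "norm (cform c x) < 1"
proof -
  obtain s where s: "1 < s" "s *\<^sub>R x \<in> D"
    using open_scale_up[OF assms(1,3)] by blast
  then have "s * norm (cform c x) \<le> 1"
    using assms(2) by (auto simp: polar_def cform_scaleR norm_mult dest!: bspec)
  then have "norm (cform c x) \<le> 1 / s"
    using s(1) by (simp add: field_simps)
  also have "\<dots> < 1"
    using s(1) by simp
  finally show ?thesis .
qed

text \<open>A real separating functional is the real part of a complex linear one. Balancedness
  allows every value on \<open>D\<close> to be rotated onto the positive axis, so a bound on real
  parts over \<open>D\<close> bounds moduli.\<close>

lemma polar_separates:
  assumes "convex D" "balanced D" "D \<noteq> {}" "w \<notin> closure D"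
  obtains c where "c \<in> polar D" "1 < norm (cform c w)"
proof -
  obtain a b where ab: "inner a w < b" "\<And>x. x \<in> closure D \<Longrightarrow> b < inner a x"
    using separating_hyperplane_closed_point[of "closure D" w] assms convex_closure by auto
  have b: "b < 0"
    using ab(2)[of 0] balanced_zero[OF assms(2,3)] closure_subset[of D] by auto
  \<comment> \<open>The real part of this form is \<open>inner a x / b\<close>. Since
    \<open>b\<close> is negative, the division reverses the separation: values below 1 on
    \<open>D\<close>, above 1 at \<open>w\<close>.\<close>
  define c where "c = (\<chi> i. cnj (a $ i) / of_real b)"
  have Re: "Re (cform c x) = inner a x / b" for x
    by (simp add: cform_def c_def inner_vec_def inner_complex_def sum_divide_distrib
        add_divide_distrib)
  show ?thesis
  proof
    show "c \<in> polar D"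
      unfolding polar_def
    proof (intro CollectI ballI)
      fix x assume x: "x \<in> D"
      define u where "u = cform c x"
      show "norm (cform c x) \<le> 1"
      proof (cases "u = 0")
        case False
        define \<theta> where "\<theta> = cnj u / of_real (norm u)"
        have "norm \<theta> = 1"
          using False by (simp add: \<theta>_def norm_divide)
        then have "\<theta> *s x \<in> D"
          using x assms(2) by (simp add: balanced_def)
        then have "Re (cform c (\<theta> *s x)) < 1"
          using ab(2)[of "\<theta> *s x"] b closure_subset[of D] by (auto simp: Re divide_less_eq)
        moreover have "cform c (\<theta> *s x) = of_real (norm u)"
          using False complex_norm_square[of u]
          by (simp add: cform_scale u_def[symmetric] \<theta>_def mult.commute power2_eq_square divide_eq_eq)
        ultimately show ?thesis
          by (simp add: u_def)
      qed (simp add: u_def)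
    qed
    have "1 < Re (cform c w)"
      using ab(1) b by (simp add: Re less_divide_eq)
    then show "1 < norm (cform c w)"
      using complex_Re_le_cmod[of "cform c w"] by linarith
  qed
qed

section \<open>Chains of discs and Kobayashi balls\<close>

definition kobayashi_chain ::
  "(complex ^ 'n) set \<Rightarrow> complex ^ 'n \<Rightarrow> complex ^ 'n \<Rightarrow> nat \<Rightarrow> (nat \<Rightarrow> complex) \<Rightarrow> (nat \<Rightarrow> complex) \<Rightarrow>
    (nat \<Rightarrow> complex \<Rightarrow> complex ^ 'n) \<Rightarrow> bool" where
  "kobayashi_chain D z w N a b f \<longleftrightarrow>
     N \<ge> 1 \<and>
     (\<forall>j\<in>{1..N}. a j \<in> ball 0 1 \<and> b j \<in> ball 0 1 \<and> holomorphic_disc_in (f j) D) \<and>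
     f 1 (a 1) = z \<and> (\<forall>j\<in>{1..<N}. f j (b j) = f (j + 1) (a (j + 1))) \<and> f N (b N) = w"

lemma kobayashi_dist_eq:
  "kobayashi_dist D z w =
    Inf {(\<Sum>j=1..N. poincare_dist (a j) (b j)) | N a b f. kobayashi_chain D z w N a b f}"
  unfolding kobayashi_dist_def kobayashi_chain_def ..

text \<open>Composing the disc with \<open>cform c\<close> gives a self-map of the unit disc.
  Schwarz-Pick bounds the distance of its two values, and the triangle inequality through 0 does the
  rest.\<close>

lemma artanh_cform_disc:
  assumes D: "open D" "c \<in> polar D" and f: "holomorphic_disc_in f D"
    and a: "norm a < 1" and b: "norm b < 1"
  shows "artanh (norm (cform c (f b))) \<le> artanh (norm (cform c (f a))) + poincare_dist a b"
proof -
  define F where "F = (\<lambda>\<zeta>. cform c (f \<zeta>))"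
  have hol: "F holomorphic_on ball 0 1"
    unfolding F_def using f by (intro holomorphic_on_cform) (simp add: holomorphic_disc_in_def)
  have img: "F ` ball 0 1 \<subseteq> ball 0 1"
    using f polar_strict[OF D] by (auto simp: F_def holomorphic_disc_in_def image_subset_iff)
  have "artanh (norm (F b)) \<le> artanh (norm (F a)) + poincare_dist (F a) (F b)"
    using img a b by (intro poincare_dist_triangle_0) (auto simp: image_subset_iff)
  also have "poincare_dist (F a) (F b) \<le> poincare_dist a b"
    by (rule poincare_dist_Schwarz_Pick[OF hol img a b])
  finally show ?thesis
    by (simp add: F_def)
qed

text \<open>The estimates for the single discs telescope, because consecutive discs meet and the
  chain starts at 0, where \<open>cform c\<close> vanishes. So each functional in the polar bounds
  the Kobayashi distance from 0 from below.\<close>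

lemma artanh_cform_chain:
  assumes D: "open D" "c \<in> polar D" and chain: "kobayashi_chain D 0 w N a b f"
  shows "artanh (norm (cform c w)) \<le> (\<Sum>j=1..N. poincare_dist (a j) (b j))"
proof -
  have ch: "norm (a j) < 1" "norm (b j) < 1" "holomorphic_disc_in (f j) D" if "1 \<le> j" "j \<le> N" for j
    using chain that by (auto simp: kobayashi_chain_def)
  have "artanh (norm (cform c (f M (b M)))) \<le> (\<Sum>j=1..M. poincare_dist (a j) (b j))"
    if "1 \<le> M" "M \<le> N" for M
    using that
  proof (induction M rule: dec_induct)
    case base
    then show ?case
      using artanh_cform_disc[OF D ch(3,1,2)[of 1]] chain by (simp add: kobayashi_chain_def)
  next
    case (step n)
    have "f n (b n) = f (Suc n) (a (Suc n))"
      using chain step.hyps step.prems by (simp add: kobayashi_chain_def)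
    then show ?case
      using artanh_cform_disc[OF D ch(3,1,2)[of "Suc n"]] step.IH step.hyps step.prems by simp
  qed
  from this[of N] show ?thesis
    using chain by (simp add: kobayashi_chain_def)
qed

lemma kobayashi_chain_radial:
  assumes "balanced D" "d \<in> D" "0 \<le> \<rho>" "\<rho> < 1"
  shows "kobayashi_chain D 0 (\<rho> *\<^sub>R d) 1 (\<lambda>_. 0) (\<lambda>_. of_real \<rho>) (\<lambda>_ \<zeta>. \<zeta> *s d)"
proof -
  have "holomorphic_disc_in (\<lambda>\<zeta>. \<zeta> *s d) D"
    using assms(1,2) by (auto simp: holomorphic_disc_in_def balanced_def intro!: holomorphic_intros)
  then show ?thesis
    using assms(3,4) by (simp add: kobayashi_chain_def of_real_vector_scalar_mult)
qed

text \<open>The bound from above needs only one disc, the linear one through \<open>d\<close>,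
  followed from 0 to \<open>\<rho>\<close>.\<close>

lemma kobayashi_dist_radial_le:
  assumes "balanced D" "d \<in> D" "0 \<le> \<rho>" "\<rho> < 1"
  shows "kobayashi_dist D 0 (\<rho> *\<^sub>R d) \<le> artanh \<rho>"
  unfolding kobayashi_dist_eq
proof (rule cInf_lower)
  show "bdd_below {(\<Sum>j=1..N. poincare_dist (a j) (b j)) | N a b f. kobayashi_chain D 0 (\<rho> *\<^sub>R d) N a b f}"
    by (rule bdd_belowI[of _ 0])
      (auto intro!: sum_nonneg poincare_dist_nonneg simp: kobayashi_chain_def)
  show "artanh \<rho> \<in> {(\<Sum>j=1..N. poincare_dist (a j) (b j)) | N a b f. kobayashi_chain D 0 (\<rho> *\<^sub>R d) N a b f}"
    apply (rule CollectI, rule exI[of _ 1], rule exI[of _ "\<lambda>_. 0"], rule exI[of _ "\<lambda>_. of_real \<rho>"],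
        rule exI[of _ "\<lambda>_ \<zeta>. \<zeta> *s d"])
    using kobayashi_chain_radial[OF assms] assms(3) by (simp add: poincare_dist_def)
qed

lemma artanh_cform_less_kobayashi:
  assumes D: "open D" "balanced D" "c \<in> polar D" and w: "w \<in> D" "kobayashi_dist D 0 w < r"
  shows "artanh (norm (cform c w)) < r"
proof -
  obtain s where s: "1 < s" "s *\<^sub>R w \<in> D"
    using open_scale_up[OF D(1) w(1)] by blast
  define S where "S = {(\<Sum>j=1..N. poincare_dist (a j) (b j)) | N a b f. kobayashi_chain D 0 w N a b f}"
  \<comment> \<open>One chain is exhibited so that the infimum is over a nonempty set: the linear
    disc through \<open>s\<close> times \<open>w\<close> reaches \<open>w\<close> at the parameter
    \<open>1 / s\<close>, which is below 1.\<close>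
  have "kobayashi_chain D 0 w 1 (\<lambda>_. 0) (\<lambda>_. of_real (1 / s)) (\<lambda>_ \<zeta>. \<zeta> *s (s *\<^sub>R w))"
    using kobayashi_chain_radial[OF D(2) s(2), of "1 / s"] s(1) by simp
  then have "S \<noteq> {}"
    unfolding S_def by blast
  moreover have "Inf S < r"
    using w(2) unfolding kobayashi_dist_eq S_def .
  ultimately obtain x where "x \<in> S" "x < r"
    using cInf_lessD by meson
  then show ?thesis
    unfolding S_def using artanh_cform_chain[OF D(1,3)] by force
qed

text \<open>The strict inequality in the Kobayashi ball comes from using the disc through the larger
  point \<open>s\<close> times \<open>d\<close>, which reaches the given point already at the
  parameter \<open>tanh r / s\<close>.\<close>

lemma scaling_subset_kobayashi_ball:
  assumes D: "open D" "balanced D" and r: "0 < r"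
  shows "(*\<^sub>R) (tanh r) ` D \<subseteq> kobayashi_ball D 0 r"
proof clarify
  fix d assume "d \<in> D"
  then obtain s where s: "1 < s" "s *\<^sub>R d \<in> D"
    using open_scale_up[OF D(1)] by blast
  have t: "0 < tanh r" "tanh r < 1"
    using r by (auto simp: tanh_real_lt_1)
  have less: "tanh r / s < tanh r"
    using s t by (simp add: divide_less_eq)
  have "kobayashi_dist D 0 ((tanh r / s) *\<^sub>R (s *\<^sub>R d)) \<le> artanh (tanh r / s)"
    by (rule kobayashi_dist_radial_le[OF D(2) s(2)]) (use s t less in auto)
  moreover have "\<not> artanh (tanh r) \<le> artanh (tanh r / s)"
    using artanh_real_le_iff[of "tanh r" "tanh r / s"] less s t by auto
  moreover have "tanh r *\<^sub>R d \<in> D"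
    by (rule balanced_scaleR[OF D(2) \<open>d \<in> D\<close>]) (use t in auto)
  ultimately show "tanh r *\<^sub>R d \<in> kobayashi_ball D 0 r"
    using s(1) by (simp add: kobayashi_ball_def artanh_tanh_real)
qed

text \<open>If \<open>w\<close> divided by \<open>tanh r\<close> were outside the closure of
  \<open>D\<close>, some functional in the polar would exceed \<open>tanh r\<close> in modulus at
  \<open>w\<close> and force the distance up to \<open>r\<close>. The gap between
  \<open>tanh r\<close> and \<open>\<rho>\<close> leads from the closure back into \<open>D\<close>;
  it disappears in the suprema.\<close>

lemma kobayashi_ball_subset_scaling:
  assumes D: "open D" "balanced D" "convex D" and r: "0 < r" "tanh r < \<rho>"
  shows "kobayashi_ball D 0 r \<subseteq> (*\<^sub>R) \<rho> ` D"
proof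
  fix w assume w: "w \<in> kobayashi_ball D 0 r"
  have t: "0 < tanh r" "tanh r < 1"
    using r by (auto simp: tanh_real_lt_1)
  have \<rho>: "0 < \<rho>"
    using t r by linarith
  have wD: "w \<in> D" "kobayashi_dist D 0 w < r"
    using w by (auto simp: kobayashi_ball_def)
  have "(1 / tanh r) *\<^sub>R w \<in> closure D"
  proof (rule ccontr)
    assume "(1 / tanh r) *\<^sub>R w \<notin> closure D"
    then obtain c where c: "c \<in> polar D" "1 < norm (cform c ((1 / tanh r) *\<^sub>R w))"
      using polar_separates[OF D(3,2)] wD(1) by blast
    then have "tanh r < norm (cform c w)"
      using t by (simp add: cform_scaleR norm_mult norm_divide field_simps)
    moreover have "norm (cform c w) < 1"
      by (rule polar_strict[OF D(1) c(1) wD(1)])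
    ultimately have "artanh (tanh r) \<le> artanh (norm (cform c w))"
      using artanh_real_le_iff[of "tanh r" "norm (cform c w)"] t by simp
    with artanh_cform_less_kobayashi[OF D(1,2) c(1) wD] show False
      by (simp add: artanh_tanh_real)
  qed
  then have "(tanh r / \<rho>) *\<^sub>R (1 / tanh r) *\<^sub>R w \<in> D"
    by (rule scaleR_closure_in_open_convex[OF D(1,3), rotated])
      (use balanced_zero[OF D(2)] wD(1) r t \<rho> in auto)
  then have "(1 / \<rho>) *\<^sub>R w \<in> D"
    using t by simp
  then show "w \<in> (*\<^sub>R) \<rho> ` D"
    using r t by (intro image_eqI[of _ _ "(1 / \<rho>) *\<^sub>R w"]) auto
qed

section \<open>Holomorphic maps of several variables\<close>

lemma bounded_linear_scalar_mult_left: "bounded_linear (\<lambda>h::complex. h *s (v :: complex ^ 'n))"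
proof -
  have "norm (h *s v) \<le> norm h * norm v" for h :: complex
    by (simp add: norm_vector_scalar_mult)
  moreover have "(r *\<^sub>R h) *s v = r *\<^sub>R (h *s v)" for r and h :: complex
    by (simp only: vec_eq_iff vector_smult_component vector_scaleR_component mult_scaleR_left) simp
  ultimately show ?thesis
    by (intro bounded_linear_intro[where K = "norm v"]) (auto simp: vector_sadd_rdistrib)
qed

text \<open>The derivative read as a complex matrix, so that \<open>det\<close> is the complex
  Jacobian determinant. It represents the derivative only where that is complex linear.\<close>

definition complex_jacobian :: "(complex ^ 'n \<Rightarrow> complex ^ 'm) \<Rightarrow> complex ^ 'n \<Rightarrow> complex ^ 'n ^ 'm" where
  "complex_jacobian f z = matrix (frechet_derivative f (at z))"

lemma holomorphic_map_on_jacobian: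
  assumes "holomorphic_map_on f U" "open U" "z \<in> U"
  shows "(f has_derivative (*v) (complex_jacobian f z)) (at z)"
proof -
  obtain f' where f': "(f has_derivative f') (at z)" "\<And>c v. f' (c *s v) = c *s f' v"
    using assms at_within_open[of z U] unfolding holomorphic_map_on_def by metis
  have "Vector_Spaces.linear (*s) (*s) f'"
    using f' has_derivative_linear[OF f'(1)]
    by (auto simp: Vector_Spaces.linear_iff linear_iff vec.vector_space_axioms)
  then have "(*v) (matrix f') = f'"
    using matrix_works by blast
  with f'(1) frechet_derivative_at[OF f'(1)] show ?thesis
    unfolding complex_jacobian_def by metis
qed

lemma holomorphic_map_on_continuous:
  assumes "holomorphic_map_on f U"
  shows "continuous_on U f"
  using assms has_derivative_continuous
  unfolding holomorphic_map_on_def continuous_on_eq_continuous_within by blast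

text \<open>The form \<open>h *s v\<close> of the derivative expresses complex linearity in one
  variable. Restricting to such curves reduces the several-variable arguments to one-variable
  function theory.\<close>

definition holomorphic_curve :: "(complex \<Rightarrow> complex ^ 'n) \<Rightarrow> complex set \<Rightarrow> bool" where
  "holomorphic_curve \<gamma> S \<longleftrightarrow> (\<forall>\<zeta>\<in>S. \<exists>v. (\<gamma> has_derivative (\<lambda>h. h *s v)) (at \<zeta>))"

lemma holomorphic_curve_affine:
  "holomorphic_curve (\<lambda>\<zeta>. z + \<zeta> *s v) S"
  unfolding holomorphic_curve_def
  by (auto intro!: exI[of _ v] derivative_eq_intros
      bounded_linear_imp_has_derivative[OF bounded_linear_scalar_mult_left])

lemma holomorphic_curve_add_const:
  "holomorphic_curve \<gamma> S \<Longrightarrow> holomorphic_curve (\<lambda>\<zeta>. \<gamma> \<zeta> + c) S"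
  unfolding holomorphic_curve_def by (metis has_derivative_add_const)

lemma holomorphic_curve_subset:
  "holomorphic_curve \<gamma> S \<Longrightarrow> T \<subseteq> S \<Longrightarrow> holomorphic_curve \<gamma> T"
  unfolding holomorphic_curve_def by blast

lemma cform_curve_derivative:
  assumes "(\<gamma> has_derivative (\<lambda>h. h *s v)) (at \<zeta>)"
  shows "((\<lambda>\<zeta>. cform c (\<gamma> \<zeta>)) has_field_derivative cform c v) (at \<zeta>)"
  using bounded_linear.has_derivative[OF bounded_linear_cform assms, of c]
  by (simp add: has_field_derivative_def cform_scale mult.commute[of _ "cform c v"])

lemma holomorphic_curve_cform:
  assumes "holomorphic_curve \<gamma> S"
  shows "(\<lambda>\<zeta>. cform c (\<gamma> \<zeta>)) holomorphic_on S"
  using assms cform_curve_derivative[THEN has_field_derivative_at_within]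
  unfolding holomorphic_curve_def holomorphic_on_def field_differentiable_def by blast

lemma cform_axis: "cform (axis i 1) x = x $ i"
  by (simp add: cform_def axis_def if_distrib[of "\<lambda>c. c * _"] cong: if_cong)

lemma holomorphic_curve_nth:
  fixes \<gamma> :: "complex \<Rightarrow> complex ^ 'n"
  assumes "holomorphic_curve \<gamma> S"
  shows "(\<lambda>\<zeta>. \<gamma> \<zeta> $ i) holomorphic_on S"
  using holomorphic_curve_cform[OF assms, of "axis i 1"] by (simp add: cform_axis)

lemma curve_compose_derivative:
  fixes A :: "complex ^ 'n ^ 'm"
  assumes "(f has_derivative (*v) A) (at (\<gamma> \<zeta>))" "(\<gamma> has_derivative (\<lambda>h. h *s v)) (at \<zeta>)"
  shows "((\<lambda>\<zeta>. f (\<gamma> \<zeta>)) has_derivative (\<lambda>h. h *s (A *v v))) (at \<zeta>)"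
proof -
  have "(\<lambda>h. A *v (h *s v)) = (\<lambda>h. h *s (A *v v))"
    by (simp add: vector_scalar_commute)
  then show ?thesis
    using has_derivative_compose[OF assms(2,1)] by simp
qed

lemma holomorphic_curve_compose:
  assumes f: "holomorphic_map_on f U" "open U" and \<gamma>: "holomorphic_curve \<gamma> S" "\<gamma> ` S \<subseteq> U"
  shows "holomorphic_curve (\<lambda>\<zeta>. f (\<gamma> \<zeta>)) S"
  unfolding holomorphic_curve_def
proof
  fix \<zeta> assume \<zeta>: "\<zeta> \<in> S"
  then obtain v where "(\<gamma> has_derivative (\<lambda>h. h *s v)) (at \<zeta>)"
    using \<gamma>(1) by (auto simp: holomorphic_curve_def)
  then have "((\<lambda>\<zeta>. f (\<gamma> \<zeta>)) has_derivative (\<lambda>h. h *s (complex_jacobian f (\<gamma> \<zeta>) *v v))) (at \<zeta>)"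
    using curve_compose_derivative[OF holomorphic_map_on_jacobian[OF f]] \<gamma>(2) \<zeta> by blast
  then show "\<exists>v. ((\<lambda>\<zeta>. f (\<gamma> \<zeta>)) has_derivative (\<lambda>h. h *s v)) (at \<zeta>)"
    by blast
qed

lemma holomorphic_curve_imp_continuous_on:
  "holomorphic_curve \<gamma> S \<Longrightarrow> continuous_on S \<gamma>"
  unfolding holomorphic_curve_def
  using has_derivative_continuous continuous_at_imp_continuous_on by blast

text \<open>This is the first-order Taylor estimate, with the second derivative bounded by Cauchy's
  inequality on circles of radius \<open>d / 4\<close>, whence
  \<open>2 * M / (d / 4)\<^sup>2\<close>. The bound involves \<open>F\<close> only through
  \<open>M\<close>, so it is uniform over families of functions.\<close>

lemma difference_quotient_estimate:
  assumes hol: "F holomorphic_on ball 0 d" and M: "\<And>z. z \<in> ball 0 d \<Longrightarrow> norm (F z) \<le> M"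
    and \<xi>: "\<xi> \<noteq> 0" "norm \<xi> < d / 2"
  shows "norm ((F \<xi> - F 0) / \<xi> - deriv F 0) \<le> 32 * M / d\<^sup>2 * norm \<xi>"
proof -
  have d: "0 < d"
    using \<xi>(2) norm_ge_zero[of \<xi>] by linarith
  define f where "f i = (deriv ^^ i) F" for i
  have "norm (f 0 \<xi> - (\<Sum>i\<le>1. f i 0 * (\<xi> - 0) ^ i / fact i)) \<le>
      (32 * M / d\<^sup>2) * norm (\<xi> - 0) ^ Suc 1 / fact 1"
  proof (rule complex_Taylor[of "ball 0 (d / 2)"])
    fix i and x :: complex assume x: "x \<in> ball 0 (d / 2)"
    have "x \<in> ball 0 d"
      using x d by simp
    then show "(f i has_field_derivative f (Suc i) x) (at x within ball 0 (d / 2))"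
      unfolding f_def
      by (simp add: holomorphic_derivI[OF holomorphic_higher_deriv[OF hol open_ball] open_ball])
  next
    fix x assume x: "x \<in> ball (0::complex) (d / 2)"
    have sub: "cball x (d / 4) \<subseteq> ball 0 d"
    proof
      fix y assume "y \<in> cball x (d / 4)"
      then have "norm (y - x) \<le> d / 4"
        by (simp add: dist_norm norm_minus_commute)
      then show "y \<in> ball 0 d"
        using norm_triangle_ineq[of x "y - x"] x d by simp
    qed
    have "norm ((deriv ^^ 2) F x) \<le> fact 2 * M / (d / 4) ^ 2"
    proof (rule Cauchy_inequality)
      show "F holomorphic_on ball x (d / 4)"
        using hol sub ball_subset_cball by (meson holomorphic_on_subset order_trans)
      show "continuous_on (cball x (d / 4)) F"
        using hol sub holomorphic_on_imp_continuous_on holomorphic_on_subset by blast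
      show "norm (F y) \<le> M" if "norm (x - y) = d / 4" for y
        using that sub by (intro M) (auto simp: dist_norm)
    qed (use d in simp)
    then show "norm (f (Suc 1) x) \<le> 32 * M / d\<^sup>2"
      by (simp add: f_def numeral_2_eq_2[symmetric] power_divide)
  qed (use \<xi> d in auto)
  then have est: "norm (F \<xi> - F 0 - deriv F 0 * \<xi>) \<le> 32 * M / d\<^sup>2 * norm \<xi> * norm \<xi>"
    by (simp add: f_def power2_eq_square algebra_simps)
  have "(F \<xi> - F 0) / \<xi> - deriv F 0 = (F \<xi> - F 0 - deriv F 0 * \<xi>) / \<xi>"
    using \<xi>(1) by (simp add: field_simps)
  then have "norm ((F \<xi> - F 0) / \<xi> - deriv F 0) = norm (F \<xi> - F 0 - deriv F 0 * \<xi>) / norm \<xi>"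
    by (simp add: norm_divide)
  also have "\<dots> \<le> 32 * M / d\<^sup>2 * norm \<xi>"
    using est \<xi>(1) by (simp add: pos_divide_le_eq)
  finally show ?thesis .
qed

lemma jacobian_entry_eq:
  fixes f :: "complex ^ 'n \<Rightarrow> complex ^ 'm"
  assumes "holomorphic_map_on f U" "open U" "z \<in> U"
  shows "((\<lambda>\<xi>. f (z + \<xi> *s axis j 1) $ i) has_field_derivative complex_jacobian f z $ i $ j) (at 0)"
proof -
  have 1: "((\<lambda>\<xi>. z + \<xi> *s axis j 1) has_derivative (\<lambda>h. h *s axis j 1)) (at 0)"
    by (auto intro!: derivative_eq_intros
      bounded_linear_imp_has_derivative[OF bounded_linear_scalar_mult_left])
  have 2: "(f has_derivative (*v) (complex_jacobian f z)) (at (z + 0 *s axis j 1))"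
    using holomorphic_map_on_jacobian[OF assms] by simp
  have "(complex_jacobian f z *v axis j 1) $ i = complex_jacobian f z $ i $ j"
    by (simp add: matrix_vector_mult_def axis_def if_distrib[of "\<lambda>c. _ * c"] cong: if_cong)
  then show ?thesis
    using cform_curve_derivative[OF curve_compose_derivative[OF 2 1], of "axis i 1"]
    by (simp add: cform_axis)
qed

text \<open>The error in \<open>difference_quotient_estimate\<close> depends only on a bound for
  \<open>f\<close> near \<open>z0\<close>, so it is the same for all base points \<open>z\<close>.
  Uniform convergence is what hands continuity and holomorphy on to the Jacobian, about whose
  regularity \<open>holomorphic_map_on\<close> says nothing directly.\<close>

lemma jacobian_entry_uniform_limit:
  fixes f :: "complex ^ 'n \<Rightarrow> complex ^ 'm"
  assumes f: "holomorphic_map_on f U" "open U" and z0: "z0 \<in> U"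
  obtains d t where "0 < d" "\<And>n. t n \<noteq> 0"
    "\<And>z n. z \<in> cball z0 d \<Longrightarrow> z \<in> U \<and> z + t n *s axis j 1 \<in> U"
    "uniform_limit (cball z0 d) (\<lambda>n z. (f (z + t n *s axis j 1) $ i - f z $ i) / t n)
       (\<lambda>z. complex_jacobian f z $ i $ j) sequentially"
proof -
  obtain e where e: "0 < e" "cball z0 e \<subseteq> U"
    using f(2) z0 open_contains_cball by blast
  \<comment> \<open>Base points within \<open>d\<close> of \<open>z0\<close>, moved by at most
    \<open>d\<close>, stay in \<open>cball z0 e\<close>; steps of length at most
    \<open>d / 4\<close> satisfy the requirement of the estimate.\<close>
  define d where "d = e / 2"
  define t where "t n = complex_of_real (d / 4 / real (Suc n))" for n
  have d: "0 < d"
    using e by (simp add: d_def)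
  have t0: "t n \<noteq> 0" for n
    using d by (simp add: t_def del: of_nat_Suc)
  have norm_t: "norm (t n) = d / 4 / real (Suc n)" for n
    using d unfolding t_def norm_of_real by simp
  have t_le: "norm (t n) \<le> d / 4" for n
    unfolding norm_t using d by (simp add: divide_le_eq)
  have near: "z + \<xi> *s axis j 1 \<in> cball z0 e" if "z \<in> cball z0 d" "norm \<xi> \<le> d" for z \<xi>
  proof -
    have "norm (z - z0 + \<xi> *s axis j 1) \<le> norm (z - z0) + norm (\<xi> *s axis j 1)"
      by (rule norm_triangle_ineq)
    also have "\<dots> \<le> d + d"
      using that by (intro add_mono) (auto simp: norm_vector_scalar_mult norm_axis_1 dist_norm norm_minus_commute)
    finally show ?thesis
      by (simp add: dist_norm d_def norm_minus_commute algebra_simps)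
  qed
  have "bounded ((\<lambda>z. f z $ i) ` cball z0 e)"
    by (intro compact_imp_bounded compact_continuous_image continuous_intros compact_cball
        continuous_on_subset[OF holomorphic_map_on_continuous[OF f(1)] e(2)])
  then obtain M where M: "\<And>z. z \<in> cball z0 e \<Longrightarrow> norm (f z $ i) \<le> M"
    unfolding bounded_iff by blast
  define C where "C = 32 * M / d\<^sup>2"
  have est: "norm ((f (z + t n *s axis j 1) $ i - f z $ i) / t n - complex_jacobian f z $ i $ j) \<le> C * norm (t n)"
    if z: "z \<in> cball z0 d" for z n
  proof -
    define F where "F \<xi> = f (z + \<xi> *s axis j 1) $ i" for \<xi>
    have zU: "z \<in> U"
      using near[OF z, of 0] d e(2) by auto
    have hol: "F holomorphic_on ball 0 d"
      unfolding F_def using near[OF z] e(2)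
      by (intro holomorphic_curve_nth holomorphic_curve_compose[OF f] holomorphic_curve_affine)
        (auto simp: subset_iff)
    have "norm ((F (t n) - F 0) / t n - deriv F 0) \<le> 32 * M / d\<^sup>2 * norm (t n)"
      using near[OF z] t0[of n] t_le[of n] d
      by (intro difference_quotient_estimate[OF hol]) (auto simp: F_def intro!: M)
    moreover have "deriv F 0 = complex_jacobian f z $ i $ j"
      unfolding F_def by (rule DERIV_imp_deriv[OF jacobian_entry_eq[OF f zU]])
    ultimately show ?thesis
      by (simp add: F_def C_def)
  qed
  have "uniform_limit (cball z0 d) (\<lambda>n z. (f (z + t n *s axis j 1) $ i - f z $ i) / t n)
       (\<lambda>z. complex_jacobian f z $ i $ j) sequentially"
  proof (rule uniform_limitI)
    fix \<epsilon> :: real assume \<epsilon>: "0 < \<epsilon>"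
    have "(\<lambda>n. C * (d / 4 / real (Suc n))) \<longlonglongrightarrow> 0"
      by (intro tendsto_mult_right_zero tendsto_divide_0[OF tendsto_const] filterlim_compose[OF filterlim_real_at_infinity_sequentially filterlim_Suc])
    then have "(\<lambda>n. C * norm (t n)) \<longlonglongrightarrow> 0"
      by (simp add: norm_t)
    then have "\<forall>\<^sub>F n in sequentially. C * norm (t n) < \<epsilon>"
      using \<epsilon> order_tendstoD(2) by blast
    then show "\<forall>\<^sub>F n in sequentially. \<forall>z\<in>cball z0 d.
        dist ((f (z + t n *s axis j 1) $ i - f z $ i) / t n) (complex_jacobian f z $ i $ j) < \<epsilon>"
    proof eventually_elim
      case (elim n)
      show ?case
      proof
        fix z assume "z \<in> cball z0 d"
        from le_less_trans[OF est[OF this] elim]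
        show "dist ((f (z + t n *s axis j 1) $ i - f z $ i) / t n) (complex_jacobian f z $ i $ j) < \<epsilon>"
          by (simp add: dist_norm)
      qed
    qed
  qed
  moreover have "z \<in> U \<and> z + t n *s axis j 1 \<in> U" if "z \<in> cball z0 d" for z n
    using near[OF that, of 0] near[OF that, of "t n"] t_le[of n] d e(2) by auto
  ultimately show ?thesis
    using that d t0 by blast
qed

lemma continuous_on_jacobian_entry:
  fixes f :: "complex ^ 'n \<Rightarrow> complex ^ 'm"
  assumes f: "holomorphic_map_on f U" "open U"
  shows "continuous_on U (\<lambda>z. complex_jacobian f z $ i $ j)"
proof (rule continuous_at_imp_continuous_on, rule ballI)
  fix z0 assume "z0 \<in> U"
  then obtain d t where dt: "0 < d" "\<And>n. t n \<noteq> 0"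
    "\<And>z n. z \<in> cball z0 d \<Longrightarrow> z \<in> U \<and> z + t n *s axis j 1 \<in> U"
    "uniform_limit (cball z0 d) (\<lambda>n z. (f (z + t n *s axis j 1) $ i - f z $ i) / t n)
       (\<lambda>z. complex_jacobian f z $ i $ j) sequentially"
    using jacobian_entry_uniform_limit[OF f] by blast
  note cont = continuous_on_compose2[OF holomorphic_map_on_continuous[OF f(1)]]
  have "continuous_on (cball z0 d) (\<lambda>z. complex_jacobian f z $ i $ j)"
    by (rule uniform_limit_theorem[OF _ dt(4)])
      (use dt(2,3) in \<open>auto intro!: always_eventually continuous_intros cont\<close>)
  then show "continuous (at z0) (\<lambda>z. complex_jacobian f z $ i $ j)"
    by (rule continuous_on_interior) (simp add: dt(1))
qed

text \<open>Along the curve the difference quotients are holomorphic, because a translate of a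
  holomorphic curve is again one, and locally uniform limits preserve holomorphy.\<close>

lemma holomorphic_on_jacobian_entry:
  fixes f :: "complex ^ 'n \<Rightarrow> complex ^ 'm"
  assumes f: "holomorphic_map_on f U" "open U" and \<gamma>: "holomorphic_curve \<gamma> S" "\<gamma> ` S \<subseteq> U" "open S"
  shows "(\<lambda>\<zeta>. complex_jacobian f (\<gamma> \<zeta>) $ i $ j) holomorphic_on S"
proof -
  have cont: "continuous_on S \<gamma>"
    by (rule holomorphic_curve_imp_continuous_on[OF \<gamma>(1)])
  have "\<exists>T. open T \<and> \<zeta>0 \<in> T \<and> T \<subseteq> S \<and> (\<lambda>\<zeta>. complex_jacobian f (\<gamma> \<zeta>) $ i $ j) holomorphic_on T"
    if \<zeta>0: "\<zeta>0 \<in> S" for \<zeta>0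
  proof -
    obtain d t where dt: "0 < d" "\<And>n. t n \<noteq> 0"
      "\<And>z n. z \<in> cball (\<gamma> \<zeta>0) d \<Longrightarrow> z \<in> U \<and> z + t n *s axis j 1 \<in> U"
      "uniform_limit (cball (\<gamma> \<zeta>0) d) (\<lambda>n z. (f (z + t n *s axis j 1) $ i - f z $ i) / t n)
         (\<lambda>z. complex_jacobian f z $ i $ j) sequentially"
      using jacobian_entry_uniform_limit[OF f, of "\<gamma> \<zeta>0"] \<gamma>(2) \<zeta>0 by blast
    \<comment> \<open>Holomorphy is local, so the curve may be restricted to parameters for which it
      stays in the ball of uniform convergence.\<close>
    define T where "T = S \<inter> \<gamma> -` ball (\<gamma> \<zeta>0) d"
    have T: "open T" "\<zeta>0 \<in> T" "T \<subseteq> S"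
      using continuous_open_preimage[OF cont \<gamma>(3) open_ball] \<zeta>0 dt(1) by (auto simp: T_def)
    have TU: "\<gamma> \<zeta> \<in> cball (\<gamma> \<zeta>0) d" if "\<zeta> \<in> T" for \<zeta>
      using that by (auto simp: T_def)
    have \<gamma>T: "holomorphic_curve \<gamma> T"
      using holomorphic_curve_subset[OF \<gamma>(1) T(3)] .
    have "(\<lambda>\<zeta>. complex_jacobian f (\<gamma> \<zeta>) $ i $ j) holomorphic_on T"
    proof (rule holomorphic_uniform_sequence[OF T(1)])
      show "(\<lambda>\<zeta>. (f (\<gamma> \<zeta> + t n *s axis j 1) $ i - f (\<gamma> \<zeta>) $ i) / t n) holomorphic_on T" for n
      proof (rule holomorphic_on_divide[OF holomorphic_on_diff holomorphic_on_const])
        show "(\<lambda>\<zeta>. f (\<gamma> \<zeta> + t n *s axis j 1) $ i) holomorphic_on T"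
          by (rule holomorphic_curve_nth[OF holomorphic_curve_compose[OF f
              holomorphic_curve_add_const[OF \<gamma>T]]]) (use dt(3) TU in blast)
        show "(\<lambda>\<zeta>. f (\<gamma> \<zeta>) $ i) holomorphic_on T"
          by (rule holomorphic_curve_nth[OF holomorphic_curve_compose[OF f \<gamma>T]]) (use dt(3) TU in blast)
      qed (rule dt(2))
    next
      fix \<zeta> assume "\<zeta> \<in> T"
      then obtain r where r: "0 < r" "cball \<zeta> r \<subseteq> T"
        using T(1) open_contains_cball by blast
      have "uniform_limit (cball \<zeta> r) (\<lambda>n \<zeta>. (f (\<gamma> \<zeta> + t n *s axis j 1) $ i - f (\<gamma> \<zeta>) $ i) / t n)
         (\<lambda>\<zeta>. complex_jacobian f (\<gamma> \<zeta>) $ i $ j) sequentially"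
        by (rule uniform_limit_compose'[OF dt(4)]) (use r(2) TU in auto)
      then show "\<exists>r>0. cball \<zeta> r \<subseteq> T \<and> uniform_limit (cball \<zeta> r)
          (\<lambda>n \<zeta>. (f (\<gamma> \<zeta> + t n *s axis j 1) $ i - f (\<gamma> \<zeta>) $ i) / t n)
         (\<lambda>\<zeta>. complex_jacobian f (\<gamma> \<zeta>) $ i $ j) sequentially"
        using r by blast
    qed
    with T show ?thesis by blast
  qed
  then show ?thesis
    by (metis at_within_open holomorphic_on_def \<gamma>(3) in_mono)
qed

lemma continuous_on_det_jacobian:
  fixes f :: "complex ^ 'n \<Rightarrow> complex ^ 'n"
  assumes f: "holomorphic_map_on f U" "open U"
  shows "continuous_on U (\<lambda>z. det (complex_jacobian f z))"
  unfolding det_def by (intro continuous_on_sum continuous_on_mult continuous_on_prod continuous_on_const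
      continuous_on_jacobian_entry[OF f])

lemma holomorphic_on_det_jacobian:
  fixes f :: "complex ^ 'n \<Rightarrow> complex ^ 'n"
  assumes "holomorphic_map_on f U" "open U" "holomorphic_curve \<gamma> S" "\<gamma> ` S \<subseteq> U" "open S"
  shows "(\<lambda>\<zeta>. det (complex_jacobian f (\<gamma> \<zeta>))) holomorphic_on S"
  unfolding det_def by (intro holomorphic_on_sum holomorphic_on_mult holomorphic_on_prod holomorphic_on_const
      holomorphic_on_jacobian_entry[OF assms])

section \<open>Injective holomorphic maps\<close>

text \<open>Sard's theorem in equal dimensions is only available over \<open>real ^ 'm\<close> with a well-ordered
  index type; \<open>'n bit0\<close> is such a type with \<open>2 * CARD('n)\<close> elements.\<close>

lemma injective_holomorphic_regular_point:
  fixes f :: "complex ^ 'n \<Rightarrow> complex ^ 'n"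
  assumes f: "holomorphic_map_on f U" "open U" and inj: "inj_on f U"
    and Q: "open Q" "Q \<noteq> {}" "Q \<subseteq> U"
  shows "\<exists>z\<in>Q. det (complex_jacobian f z) \<noteq> 0"
proof (rule ccontr)
  assume "\<not> ?thesis"
  then have det0: "det (complex_jacobian f z) = 0" if "z \<in> Q" for z
    using that by blast
  have "DIM(real ^ 'n bit0) = DIM(complex ^ 'n)"
    by simp
  then obtain T :: "real ^ 'n bit0 \<Rightarrow> complex ^ 'n" and g
    where T: "linear T" "linear g" "\<And>x. g (T x) = x" "\<And>y. T (g y) = y"
    using isomorphisms_UNIV_UNIV[where 'M = "real ^ 'n bit0" and 'N = "complex ^ 'n"] by metis
  have bl: "bounded_linear T" "bounded_linear g"
    using T linear_conv_bounded_linear by blast+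
  have surjg: "surj g"
    using T(3) by (metis surjI)
  define F where "F x = g (f (T x))" for x
  define F' where "F' x v = g (complex_jacobian f (T x) *v T v)" for x v
  have der: "(F has_derivative F' x) (at x within g ` Q)" if x: "x \<in> g ` Q" for x
  proof -
    have "T x \<in> U"
      using x Q(3) T(4) by auto
    then have "(f has_derivative (*v) (complex_jacobian f (T x))) (at (T x))"
      by (rule holomorphic_map_on_jacobian[OF f])
    from has_derivative_compose[OF bounded_linear_imp_has_derivative[OF bl(1)] this]
    have "((\<lambda>x. f (T x)) has_derivative (\<lambda>v. complex_jacobian f (T x) *v T v)) (at x)" .
    from bounded_linear.has_derivative[OF bl(2) this] show ?thesis
      unfolding F_def F'_def by (rule has_derivative_at_withinI)
  qed
  \<comment> \<open>A kernel vector \<open>v\<close> of the complex Jacobian yields the kernel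
    vector \<open>g v\<close> of the real derivative, so the real rank is not full.\<close>
  have rank: "rank (matrix (F' x)) < CARD('n bit0)" if x: "x \<in> g ` Q" for x
  proof -
    have "det (complex_jacobian f (T x)) = 0"
      using x T(4) by (auto intro: det0)
    then have "\<not> (\<exists>B. B ** complex_jacobian f (T x) = mat 1)"
      by (metis invertible_det_nz invertible_left_inverse)
    then obtain v where v: "complex_jacobian f (T x) *v v = 0" "v \<noteq> 0"
      using matrix_left_invertible_ker by blast
    have "linear (F' x)"
      using der[OF x] has_derivative_linear by blast
    then have "(*v) (matrix (F' x)) = F' x"
      using matrix_vector_mul by metis
    moreover have "F' x (g v) = F' x 0"
      using v(1) T by (simp add: F'_def linear_0)
    moreover have "g v \<noteq> 0"
      using v(2) T by (metis linear_0)
    ultimately have "\<not> inj ((*v) (matrix (F' x)))"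
      by (metis injD)
    then show ?thesis
      using less_rank_noninjective by blast
  qed
  \<comment> \<open>All points being critical, Sard makes the image negligible, whereas invariance
    of domain makes it open and nonempty.\<close>
  have "negligible (F ` g ` Q)"
    by (rule baby_Sard[OF _ der rank]) auto
  moreover have "F ` g ` Q = g ` f ` Q"
    by (simp add: F_def image_image T(4))
  moreover have "open (f ` Q)"
    by (rule invariance_of_domain)
      (use Q holomorphic_map_on_continuous[OF f(1)] inj in
        \<open>auto intro: continuous_on_subset inj_on_subset\<close>)
  then have "open (g ` f ` Q)"
    by (rule open_surjective_linear_image[OF _ T(2) surjg])
  ultimately show False
    using open_not_negligible[of "g ` f ` Q"] Q(2) by simp
qed

section \<open>The inverse of an injective holomorphic map\<close>

locale injective_holomorphic =
  fixes f :: "complex ^ 'n \<Rightarrow> complex ^ 'n" and U :: "(complex ^ 'n) set"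
  assumes holf: "holomorphic_map_on f U" and openU: "open U" and inj: "inj_on f U"
begin

definition g where "g = inv_into U f"

lemma open_image: "open (f ` U)"
  by (rule invariance_of_domain[OF holomorphic_map_on_continuous[OF holf] openU inj])

lemma g_f [simp]: "z \<in> U \<Longrightarrow> g (f z) = z"
  by (simp add: g_def inj)

lemma f_g [simp]: "w \<in> f ` U \<Longrightarrow> f (g w) = w"
  by (simp add: g_def f_inv_into_f)

lemma g_in: "w \<in> f ` U \<Longrightarrow> g w \<in> U"
  by (simp add: g_def inv_into_into)

lemma continuous_on_g: "continuous_on (f ` U) g"
  by (rule continuous_on_inverse_open[OF openU holomorphic_map_on_continuous[OF holf] _ _])
    auto

lemma isCont_g: "w \<in> f ` U \<Longrightarrow> isCont g w"
  using continuous_on_g continuous_on_eq_continuous_at open_image by blast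

text \<open>The determinant is attached to the point of the image, so its continuity needs only that
  of \<open>g\<close>. Its nonzeros in the image are the regular values.\<close>

definition \<delta> where "\<delta> w = det (complex_jacobian f (g w))"

lemma continuous_on_\<delta>: "continuous_on (f ` U) \<delta>"
  unfolding \<delta>_def
  by (rule continuous_on_compose2[OF continuous_on_det_jacobian[OF holf openU] continuous_on_g])
    (auto intro: g_in)

text \<open>An inverse already known to be continuous is differentiable wherever the derivative of
  \<open>f\<close> at the preimage is invertible, and its derivative is again a complex
  matrix.\<close>

lemma g_has_derivative:
  assumes w: "w \<in> f ` U" "\<delta> w \<noteq> 0"
  shows "\<exists>B. (g has_derivative (*v) B) (at w)"
proof -
  have "invertible (complex_jacobian f (g w))"
    using w(2) by (simp add: \<delta>_def invertible_det_nz)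
  then obtain B where B: "B ** complex_jacobian f (g w) = mat 1"
    using invertible_left_inverse by blast
  have "(g has_derivative (*v) B) (at w)"
  proof (rule has_derivative_inverse_basic[where g = g and y = w, OF holomorphic_map_on_jacobian[OF holf openU g_in[OF w(1)]]])
    show "(*v) B \<circ> (*v) (complex_jacobian f (g w)) = id"
      using B by (auto simp: fun_eq_iff matrix_vector_mul_assoc)
  qed (use w isCont_g open_image in auto)
  then show ?thesis ..
qed

text \<open>The preimage of a neighbourhood of a point of the image is open and nonempty, so it
  contains a regular point of \<open>f\<close>.\<close>

lemma regular_values_dense: "f ` U \<subseteq> closure {w \<in> f ` U. \<delta> w \<noteq> 0}"
proof
  fix w assume w: "w \<in> f ` U"
  show "w \<in> closure {w \<in> f ` U. \<delta> w \<noteq> 0}"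
    unfolding closure_iff_nhds_not_empty
  proof (intro allI impI)
    fix A V assume V: "V \<subseteq> A" "open V" "w \<in> V"
    have "open (U \<inter> f -` V)"
      by (rule continuous_open_preimage[OF holomorphic_map_on_continuous[OF holf] openU V(2)])
    moreover have "U \<inter> f -` V \<noteq> {}"
      using w V(3) by auto
    ultimately obtain z where "z \<in> U \<inter> f -` V" "det (complex_jacobian f z) \<noteq> 0"
      using injective_holomorphic_regular_point[OF holf openU inj] by blast
    then have "f z \<in> {w \<in> f ` U. \<delta> w \<noteq> 0} \<inter> A"
      using V(1) by (auto simp: \<delta>_def)
    then show "{w \<in> f ` U. \<delta> w \<noteq> 0} \<inter> A \<noteq> {}"
      by blast
  qed
qed

text \<open>The centre must be a regular value too, or else the quotient \<open>G\<close> could be unbounded near \<open>0\<close>.\<close>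

lemma inverse_Schwarz_at_regular_values:
  assumes c: "c \<in> polar U" and R: "0 < R"
    and disc: "\<And>\<zeta>. norm \<zeta> \<le> R \<Longrightarrow> p + \<zeta> *s v \<in> f ` U"
    and reg: "\<delta> p \<noteq> 0" "\<delta> (p + \<alpha> *s v) \<noteq> 0" and \<alpha>: "norm \<alpha> < R"
  shows "norm (cform c (g (p + \<alpha> *s v) - g p)) \<le> (1 + norm (cform c (g p))) / R * norm \<alpha>"
proof -
  define \<gamma> where "\<gamma> \<zeta> = g (p + \<zeta> *s v)" for \<zeta>
  define k where "k \<zeta> = \<delta> (p + \<zeta> *s v)" for \<zeta>
  define F where "F \<zeta> = cform c (\<gamma> \<zeta> - g p)" for \<zeta>
  \<comment> \<open>The Schwarz quotient with its singularity at 0 filled in; \<open>F\<close> is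
    differentiable there because the centre \<open>p\<close> is a regular value.\<close>
  define G where "G \<zeta> = (if \<zeta> = 0 then deriv F 0 else (F \<zeta> - F 0) / (\<zeta> - 0))" for \<zeta>
  define S where "S = {\<zeta> \<in> ball 0 R. k \<zeta> \<noteq> 0}"
  define M where "M = (1 + norm (cform c (g p))) / R"
  have F0: "F 0 = 0"
    by (simp add: F_def \<gamma>_def)
  have cont_line: "continuous_on (cball 0 R) (\<lambda>\<zeta>. p + \<zeta> *s v)"
    using holomorphic_curve_imp_continuous_on[OF holomorphic_curve_affine] .
  have cont\<gamma>: "continuous_on (cball 0 R) \<gamma>"
    unfolding \<gamma>_def using disc by (intro continuous_on_compose2[OF continuous_on_g cont_line]) auto
  have contk: "continuous_on (cball 0 R) k"
    unfolding k_def using disc by (intro continuous_on_compose2[OF continuous_on_\<delta> cont_line]) auto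
  have contF: "continuous_on (cball 0 R) F"
    unfolding F_def cform_diff
    by (intro continuous_intros bounded_linear.continuous_on[OF bounded_linear_cform] cont\<gamma>)
  have "S = ball 0 R \<inter> k -` (- {0})"
    by (auto simp: S_def)
  then have openS: "open S"
    using continuous_open_preimage[OF continuous_on_subset[OF contk ball_subset_cball], of "- {0}"]
    by (simp add: open_Compl)
  have S0: "0 \<in> S"
    using R reg(1) by (simp add: S_def k_def)
  have SR: "S \<subseteq> cball 0 R"
    by (auto simp: S_def)
  have curve: "holomorphic_curve \<gamma> S"
    unfolding holomorphic_curve_def
  proof
    fix \<zeta> assume \<zeta>: "\<zeta> \<in> S"
    then have "p + \<zeta> *s v \<in> f ` U" "\<delta> (p + \<zeta> *s v) \<noteq> 0"
      using disc by (auto simp: S_def k_def)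
    then obtain B where B: "(g has_derivative (*v) B) (at (p + \<zeta> *s v))"
      using g_has_derivative by blast
    have "((\<lambda>\<zeta>. p + \<zeta> *s v) has_derivative (\<lambda>h. h *s v)) (at \<zeta>)"
      by (auto intro!: derivative_eq_intros
        bounded_linear_imp_has_derivative[OF bounded_linear_scalar_mult_left])
    from curve_compose_derivative[OF B this] show "\<exists>v. (\<gamma> has_derivative (\<lambda>h. h *s v)) (at \<zeta>)"
      unfolding \<gamma>_def by blast
  qed
  have \<gamma>U: "\<gamma> ` S \<subseteq> U"
    using disc by (auto simp: \<gamma>_def S_def intro!: g_in)
  have holk: "k holomorphic_on S"
    using holomorphic_on_det_jacobian[OF holf openU curve \<gamma>U openS]
    unfolding k_def \<delta>_def \<gamma>_def .
  have holF: "F holomorphic_on S"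
    unfolding F_def cform_diff by (intro holomorphic_intros holomorphic_curve_cform curve)
  have holG: "G holomorphic_on S"
    unfolding G_def by (rule pole_lemma[OF holF]) (simp add: interior_open openS S0)
  \<comment> \<open>Continuity is glued from two relatively open pieces: away from 0 it comes from
    \<open>F\<close>, on \<open>S\<close>, which contains 0, from holomorphy.\<close>
  have "continuous_on ((cball 0 R - {0}) \<union> S) G"
  proof (rule continuous_on_Un_local_open)
    have "continuous_on (cball 0 R - {0}) (\<lambda>\<zeta>. (F \<zeta> - F 0) / (\<zeta> - 0))"
      by (intro continuous_intros continuous_on_subset[OF contF]) auto
    then show "continuous_on (cball 0 R - {0}) G"
      by (rule continuous_on_cong[THEN iffD1, rotated -1]) (auto simp: G_def)
    show "continuous_on S G"
      by (rule holomorphic_on_imp_continuous_on[OF holG])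
    have eq: "(cball 0 R - {0}) \<union> S = cball 0 R"
      using S0 SR R by auto
    show "openin (top_of_set (cball 0 R - {0} \<union> S)) (cball 0 R - {0})"
      unfolding eq by (auto simp: openin_open intro!: exI[of _ "- {0}"] open_Compl)
    show "openin (top_of_set (cball 0 R - {0} \<union> S)) S"
      unfolding eq using openS SR by (auto simp: openin_open)
  qed
  moreover have "(cball 0 R - {0}) \<union> S = cball 0 R"
    using S0 SR R by auto
  ultimately have contG: "continuous_on (cball 0 R) G"
    by simp
  have "norm (G \<alpha>) \<le> M"
  proof (rule norm_le_max_where_nonzero[OF contG contk])
    show "G holomorphic_on {z \<in> ball 0 R. k z \<noteq> 0}" "k holomorphic_on {z \<in> ball 0 R. k z \<noteq> 0}"
      using holG holk by (simp_all add: S_def)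
    show "norm \<alpha> < R" "k \<alpha> \<noteq> 0"
      using \<alpha> reg(2) by (simp_all add: k_def)
    \<comment> \<open>On the circle \<open>\<gamma> \<zeta>\<close> still lies in \<open>U\<close>,
      where the form is at most 1 in modulus; subtracting \<open>g p\<close> adds the second summand
      of \<open>M\<close>.\<close>
    show "norm (G \<zeta>) \<le> M" if \<zeta>: "norm \<zeta> = R" for \<zeta>
    proof -
      have "\<gamma> \<zeta> \<in> U"
        unfolding \<gamma>_def using disc \<zeta> by (intro g_in) simp
      then have "norm (cform c (\<gamma> \<zeta>)) \<le> 1"
        using c by (simp add: polar_def)
      then have "norm (F \<zeta>) \<le> 1 + norm (cform c (g p))"
        unfolding F_def cform_diff using norm_triangle_ineq4 by (meson add_mono order_refl order_trans)
      then show ?thesis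
        using \<zeta> R by (auto simp: G_def F0 norm_divide M_def divide_right_mono)
    qed
  qed
  moreover have "F \<alpha> = G \<alpha> * \<alpha>"
    by (simp add: G_def F0)
  ultimately have "norm (F \<alpha>) \<le> M * norm \<alpha>"
    by (simp add: norm_mult mult_right_mono)
  then show ?thesis
    by (simp add: F_def \<gamma>_def M_def)
qed

text \<open>Since 0 and \<open>y\<close> may be critical values, both are approximated by regular
  values \<open>a m\<close> and \<open>b m\<close>. The estimate on a disc centred at
  \<open>a m\<close> and passing through \<open>b m\<close> tends to the bound \<open>t / R\<close>,
  because \<open>g 0 = 0\<close>, and then \<open>R\<close> tends to 1.\<close>

lemma inverse_Schwarz:
  assumes c: "c \<in> polar U" and U0: "0 \<in> U" "f 0 = 0"
    and V: "open V" "convex V" "balanced V" "V \<subseteq> f ` U"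
    and w: "w \<in> V" and t: "0 < t" "t < 1"
  shows "norm (cform c (g (t *\<^sub>R w))) \<le> t"
proof -
  let ?Reg = "{w \<in> f ` U. \<delta> w \<noteq> 0}"
  define y where "y = t *\<^sub>R w"
  have V0: "0 \<in> V"
    using balanced_zero[OF V(3)] w by blast
  have y: "y \<in> f ` U"
    using balanced_scaleR[OF V(3) w, of t] t V(4) by (auto simp: y_def)
  have g0: "g 0 = 0"
    using g_f[OF U0(1)] U0(2) by simp
  have cl: "0 \<in> closure ?Reg" "y \<in> closure ?Reg"
    using regular_values_dense V0 V(4) y by (auto simp only: subset_iff)
  from cl(1)[unfolded closure_sequential] obtain a where "(\<forall>m. a m \<in> ?Reg) \<and> a \<longlonglongrightarrow> 0" ..
  then have a: "a m \<in> ?Reg" "a \<longlonglongrightarrow> 0" for m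
    by (rule conjE, simp only:)+
  from cl(2)[unfolded closure_sequential] obtain b where "(\<forall>m. b m \<in> ?Reg) \<and> b \<longlonglongrightarrow> y" ..
  then have b: "b m \<in> ?Reg" "b \<longlonglongrightarrow> y" for m
    by (rule conjE, simp only:)+
  have main: "R * norm (cform c (g y)) \<le> t" if R: "t < R" "R < 1" for R
  proof -
    \<comment> \<open>With this direction the parameter \<open>t\<close> leads from
      \<open>a m\<close> exactly to \<open>b m\<close>, and \<open>v m\<close> tends to
      \<open>w\<close>.\<close>
    define v where "v m = (1 / t) *\<^sub>R (b m - a m)" for m
    have "v \<longlonglongrightarrow> (1 / t) *\<^sub>R (y - 0)"
      unfolding v_def by (intro tendsto_intros a b)
    then have "v \<longlonglongrightarrow> w"
      using t by (simp add: y_def)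
    then have ev1: "\<forall>\<^sub>F m in sequentially. v m \<in> V"
      using topological_tendstoD V(1) w by blast
    have "(\<lambda>m. (1 / (1 - R)) *\<^sub>R a m) \<longlonglongrightarrow> (1 / (1 - R)) *\<^sub>R 0"
      by (intro tendsto_intros a)
    then have ev2: "\<forall>\<^sub>F m in sequentially. (1 / (1 - R)) *\<^sub>R a m \<in> V"
      using topological_tendstoD V(1) V0 by fastforce
    have ineq: "norm (cform c (g (b m) - g (a m))) \<le> (1 + norm (cform c (g (a m)))) / R * t"
      if m: "v m \<in> V" "(1 / (1 - R)) *\<^sub>R a m \<in> V" for m
    proof -
      \<comment> \<open>Each point of the disc is a convex combination, with weights
        \<open>1 - R\<close> and \<open>R\<close>, of the enlarged centre
        \<open>a m / (1 - R)\<close> and a point of the balanced disc through \<open>v m\<close>;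
        both lie in \<open>V\<close> for large \<open>m\<close>.\<close>
      have disc: "a m + \<zeta> *s v m \<in> f ` U" if \<zeta>: "norm \<zeta> \<le> R" for \<zeta>
      proof -
        have "norm ((1 / of_real R) * \<zeta>) \<le> 1"
          using \<zeta> R t by (simp add: norm_mult norm_divide divide_le_eq)
        then have "((1 / of_real R) * \<zeta>) *s v m \<in> V"
          using V(3) m(1) by (auto simp: balanced_def)
        then have "(1 - R) *\<^sub>R ((1 / (1 - R)) *\<^sub>R a m) + R *\<^sub>R (((1 / of_real R) * \<zeta>) *s v m) \<in> V"
          using R t by (intro convexD[OF V(2) m(2)]) auto
        moreover have "R *\<^sub>R (((1 / of_real R) * \<zeta>) *s v m) = \<zeta> *s v m"
          using R t by (simp flip: of_real_vector_scalar_mult)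
        ultimately show ?thesis
          using R V(4) by auto
      qed
      have end_eq: "a m + of_real t *s v m = b m"
        using t by (simp add: v_def of_real_vector_scalar_mult)
      show ?thesis
        using inverse_Schwarz_at_regular_values[where R = R and p = "a m" and v = "v m" and \<alpha> = "of_real t", OF c _ disc]
          a(1)[of m] b(1)[of m] end_eq R t by simp
    qed
    have "0 \<in> f ` U"
      using V0 V(4) by blast
    then have ga: "(\<lambda>m. g (a m)) \<longlonglongrightarrow> g 0"
      by (rule isCont_tendsto_compose[OF isCont_g a(2)])
    have gb: "(\<lambda>m. g (b m)) \<longlonglongrightarrow> g y"
      by (rule isCont_tendsto_compose[OF isCont_g[OF y] b(2)])
    note lim_cform = tendsto_norm[OF bounded_linear.tendsto[OF bounded_linear_cform]]
    have lim1: "(\<lambda>m. norm (cform c (g (b m) - g (a m)))) \<longlonglongrightarrow> norm (cform c (g y - g 0))"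
      by (rule lim_cform[OF tendsto_diff[OF gb ga]])
    have lim2: "(\<lambda>m. (1 + norm (cform c (g (a m)))) / R * t) \<longlonglongrightarrow> (1 + norm (cform c (g 0))) / R * t"
      by (rule tendsto_mult[OF tendsto_divide[OF tendsto_add[OF tendsto_const lim_cform[OF ga]]
              tendsto_const] tendsto_const]) (use R t in simp)
    have "norm (cform c (g y - g 0)) \<le> (1 + norm (cform c (g 0))) / R * t"
    proof (rule tendsto_le[OF _ lim2 lim1])
      show "\<forall>\<^sub>F m in sequentially. norm (cform c (g (b m) - g (a m))) \<le> (1 + norm (cform c (g (a m)))) / R * t"
        using ev1 ev2 by eventually_elim (rule ineq)
    qed simp
    then show ?thesis
      using g0 R t by (simp add: field_simps)
  qed
  have "norm (cform c (g y)) \<le> t"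
  proof (rule field_le_mult_one_interval)
    fix R :: real assume R: "0 < R" "R < 1"
    show "R * norm (cform c (g y)) \<le> t"
    proof (cases "t < R")
      case True
      then show ?thesis using main R by blast
    next
      \<comment> \<open>For \<open>R\<close> not exceeding \<open>t\<close> the trivial bound 1 from
        the polar is enough.\<close>
      case False
      have "norm (cform c (g y)) \<le> 1"
        using c g_in[OF y] by (simp add: polar_def)
      then have "R * norm (cform c (g y)) \<le> R * 1"
        using R by (intro mult_left_mono) auto
      then show ?thesis using False by simp
    qed
  qed
  then show ?thesis by (simp add: y_def)
qed

text \<open>For a functional in the polar of \<open>W\<close>, the function \<open>F\<close> is a
  self-map of the disc fixing 0, and Schwarz bounds its derivative by 1. Hence no functional
  separates the image of \<open>s *\<^sub>R u\<close> from the closure of \<open>W\<close>; dividing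
  by \<open>s\<close> leads into \<open>W\<close> itself.\<close>

lemma image_derivative_subset:
  assumes U: "balanced U" "0 \<in> U" "f 0 = 0"
    and W: "open W" "convex W" "balanced W" "f ` U \<subseteq> W"
  shows "(*v) (complex_jacobian f 0) ` U \<subseteq> W"
proof (rule image_subsetI)
  fix u assume "u \<in> U"
  then obtain s where s: "1 < s" "s *\<^sub>R u \<in> U"
    using open_scale_up[OF openU] by blast
  have W0: "0 \<in> W"
    using U W(4) by (metis image_subset_iff)
  let ?L = "\<lambda>x. complex_jacobian f 0 *v x"
  have "?L (s *\<^sub>R u) \<in> closure W"
  proof (rule ccontr)
    assume "?L (s *\<^sub>R u) \<notin> closure W"
    then obtain c where c: "c \<in> polar W" "1 < norm (cform c (?L (s *\<^sub>R u)))"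
      using polar_separates[OF W(2,3)] W0 by blast
    define F where "F \<zeta> = cform c (f (\<zeta> *s (s *\<^sub>R u)))" for \<zeta>
    have img: "\<zeta> *s (s *\<^sub>R u) \<in> U" if "norm \<zeta> < 1" for \<zeta>
      using U(1) s(2) that by (auto simp: balanced_def)
    have "holomorphic_curve (\<lambda>\<zeta>. \<zeta> *s (s *\<^sub>R u)) (ball 0 1)"
      using holomorphic_curve_affine[of 0 "s *\<^sub>R u"] by simp
    then have "F holomorphic_on ball 0 1"
      unfolding F_def using img
      by (intro holomorphic_curve_cform holomorphic_curve_compose[OF holf openU]) auto
    moreover have "norm (F \<zeta>) < 1" if "norm \<zeta> < 1" for \<zeta>
      unfolding F_def using polar_strict[OF W(1) c(1)] W(4) img[OF that] by blast
    moreover have "F 0 = 0"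
      by (simp add: F_def U)
    ultimately have "norm (deriv F 0) \<le> 1"
      using Schwarz_Lemma(2)[of F 0] by simp
    moreover have "(F has_field_derivative cform c (?L (s *\<^sub>R u))) (at 0)"
    proof -
      have 1: "((\<lambda>\<zeta>. \<zeta> *s (s *\<^sub>R u)) has_derivative (\<lambda>h. h *s (s *\<^sub>R u))) (at 0)"
        by (rule bounded_linear_imp_has_derivative[OF bounded_linear_scalar_mult_left])
      have 2: "(f has_derivative (*v) (complex_jacobian f 0)) (at (0 *s (s *\<^sub>R u)))"
        using holomorphic_map_on_jacobian[OF holf openU U(2)] by simp
      show ?thesis
        unfolding F_def by (rule cform_curve_derivative[OF curve_compose_derivative[OF 2 1]])
    qed
    ultimately show False
      using c(2) DERIV_imp_deriv by fastforce
  qed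
  then have "(1 / s) *\<^sub>R ?L (s *\<^sub>R u) \<in> W"
    using s(1) by (intro scaleR_closure_in_open_convex[OF W(1,2) W0]) auto
  moreover have "(1 / s) *\<^sub>R ?L (s *\<^sub>R u) = ?L u"
    using s(1) by (simp flip: linear_cmul[OF bounded_linear.linear[OF matrix_vector_mul_bounded_linear]])
  ultimately show "?L u \<in> W" by simp
qed

text \<open>Differentiability of \<open>g\<close> at 0 is not at hand, so the rescaled points
  \<open>u m\<close> replace its derivative. The Schwarz bound for the inverse keeps them in the
  compact closure of \<open>U\<close>, and the derivative of \<open>f\<close> at 0 maps every limit
  point of them to \<open>s *\<^sub>R w\<close>.\<close>

lemma subset_image_derivative:
  assumes U: "balanced U" "convex U" "bounded U" "0 \<in> U" "f 0 = 0"
    and V: "open V" "convex V" "balanced V" "V \<subseteq> f ` U"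
  shows "V \<subseteq> (*v) (complex_jacobian f 0) ` U"
proof
  fix w assume "w \<in> V"
  then obtain s where s: "1 < s" "s *\<^sub>R w \<in> V"
    using open_scale_up[OF V(1)] by blast
  let ?L = "\<lambda>x. complex_jacobian f 0 *v x"
  \<comment> \<open>The shift by two makes every \<open>t m\<close>, including the first, strictly
    less than 1.\<close>
  define t where "t m = 1 / real (Suc (Suc m))" for m
  define u where "u m = (1 / t m) *\<^sub>R g (t m *\<^sub>R (s *\<^sub>R w))" for m
  have t: "0 < t m" "t m < 1" for m
    by (auto simp: t_def)
  have tw: "t m *\<^sub>R (s *\<^sub>R w) \<in> f ` U" for m
    using balanced_scaleR[OF V(3) s(2), of "t m"] t[of m] V(4) by auto
  have u_cl: "u m \<in> closure U" for m
  proof (rule ccontr)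
    assume "u m \<notin> closure U"
    then obtain c where c: "c \<in> polar U" "1 < norm (cform c (u m))"
      using polar_separates[OF U(2,1)] U(4) by blast
    have "norm (cform c (u m)) = norm (cform c (g (t m *\<^sub>R (s *\<^sub>R w)))) / t m"
      using t[of m] by (simp add: u_def cform_scaleR norm_mult norm_divide)
    also have "\<dots> \<le> 1"
      using inverse_Schwarz[OF c(1) U(4,5) V s(2) t] t[of m] by (simp add: divide_le_eq)
    finally show False
      using c(2) by simp
  qed
  have fu: "f (t m *\<^sub>R u m) = t m *\<^sub>R (s *\<^sub>R w)" for m
    using f_g[OF tw[of m]] t[of m] by (simp add: u_def)
  have compact: "compact (closure U)"
    using U(3) by (simp add: compact_closure)
  obtain B where B: "0 < B" "\<And>x. x \<in> closure U \<Longrightarrow> norm x \<le> B"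
    using compact_imp_bounded[OF compact] unfolding bounded_pos by blast
  have tlim: "t \<longlonglongrightarrow> 0"
    unfolding t_def by (intro tendsto_divide_0[OF tendsto_const] filterlim_compose[OF
      filterlim_real_at_infinity_sequentially] filterlim_compose[OF filterlim_Suc filterlim_Suc])
  \<comment> \<open>By construction \<open>f\<close> maps \<open>t m *\<^sub>R u m\<close> to
    \<open>t m *\<^sub>R (s *\<^sub>R w)\<close>. The \<open>u m\<close> are bounded, so dividing
    the first-order expansion of \<open>f\<close> at 0 by \<open>t m\<close> leaves an error tending
    to 0.\<close>
  have Lu: "(\<lambda>m. ?L (u m)) \<longlonglongrightarrow> s *\<^sub>R w"
  proof (rule LIMSEQ_I)
    fix e :: real assume e: "0 < e"
    have der: "(f has_derivative (*v) (complex_jacobian f 0)) (at 0)"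
      by (rule holomorphic_map_on_jacobian[OF holf openU U(4)])
    moreover have "0 < e / (2 * B)"
      using e B(1) by simp
    ultimately obtain d where d: "0 < d" "\<And>y. norm (y - 0) < d \<Longrightarrow> norm (f y - f 0 - ?L (y - 0)) \<le> e / (2 * B) * norm (y - 0)"
      unfolding has_derivative_at_alt by blast
    have "\<forall>\<^sub>F m in sequentially. t m < d / B"
      using tlim d(1) B(1) by (intro order_tendstoD(2)[of t 0]) auto
    then obtain N where N: "\<And>m. m \<ge> N \<Longrightarrow> t m < d / B"
      unfolding eventually_sequentially by blast
    have "norm (?L (u m) - s *\<^sub>R w) < e" if "m \<ge> N" for m
    proof -
      have nb: "norm (t m *\<^sub>R u m) \<le> t m * B"
        using B(2)[OF u_cl[of m]] t[of m] by (simp add: mult_left_mono)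
      also have "\<dots> < d"
        using N[OF that] B(1) by (simp add: less_divide_eq)
      finally have "norm (f (t m *\<^sub>R u m) - ?L (t m *\<^sub>R u m)) \<le> e / (2 * B) * norm (t m *\<^sub>R u m)"
        using d(2)[of "t m *\<^sub>R u m"] U(5) by simp
      also have "\<dots> \<le> e / (2 * B) * (t m * B)"
        using nb e B(1) by (intro mult_left_mono) auto
      also have "f (t m *\<^sub>R u m) - ?L (t m *\<^sub>R u m) = t m *\<^sub>R (s *\<^sub>R w - ?L (u m))"
        unfolding fu
        by (simp only: linear_cmul[OF bounded_linear.linear[OF matrix_vector_mul_bounded_linear]] scaleR_diff_right)
      finally have "t m * norm (s *\<^sub>R w - ?L (u m)) \<le> t m * (e / 2)"
        using t[of m] B(1) by (simp add: mult.commute)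
      then have "norm (s *\<^sub>R w - ?L (u m)) \<le> e / 2"
        using t[of m] by (simp add: mult_le_cancel_left)
      then show ?thesis
        using e by (simp add: norm_minus_commute)
    qed
    then show "\<exists>N. \<forall>m\<ge>N. norm (?L (u m) - s *\<^sub>R w) < e"
      by blast
  qed
  obtain x r where x: "x \<in> closure U" "strict_mono r" "(u \<circ> r) \<longlonglongrightarrow> x"
    using compact u_cl unfolding compact_def by blast
  have "(\<lambda>m. ?L ((u \<circ> r) m)) \<longlonglongrightarrow> ?L x"
    by (rule bounded_linear.tendsto[OF matrix_vector_mul_bounded_linear x(3)])
  moreover have "(\<lambda>m. ?L ((u \<circ> r) m)) \<longlonglongrightarrow> s *\<^sub>R w"
    using LIMSEQ_subseq_LIMSEQ[OF Lu x(2)] by (simp add: o_def)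
  ultimately have Lx: "?L x = s *\<^sub>R w"
    using LIMSEQ_unique by blast
  have "(1 / s) *\<^sub>R x \<in> U"
    using s(1) by (intro scaleR_closure_in_open_convex[OF openU U(2,4) x(1)]) auto
  moreover have "?L ((1 / s) *\<^sub>R x) = w"
    using Lx s(1) by (simp add: linear_cmul[OF bounded_linear.linear[OF matrix_vector_mul_bounded_linear]])
  ultimately show "w \<in> ?L ` U"
    by (metis imageI)
qed

end

text \<open>The derivative of \<open>f\<close> at 0 satisfies both inclusions. Its range contains
  \<open>V\<close>, hence a ball around 0, so it is onto and therefore invertible.\<close>

lemma linearization:
  fixes U V W :: "(complex ^ 'n) set"
  assumes f: "f \<in> inj_holomorphic_maps U W" "f 0 = 0" "V \<subseteq> f ` U"
    and U: "open U" "balanced U" "convex U" "bounded U"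
    and V: "open V" "balanced V" "convex V" "V \<noteq> {}"
    and W: "open W" "balanced W" "convex W"
  obtains A where "invertible A" "V \<subseteq> (*v) A ` U" "(*v) A ` U \<subseteq> W"
proof -
  interpret injective_holomorphic f U
    using f(1) U(1) by unfold_locales (auto simp: inj_holomorphic_maps_def)
  let ?A = "complex_jacobian f 0"
  have U0: "0 \<in> U"
    using balanced_zero[OF U(2)] V(4) f(3) by blast
  have VA: "V \<subseteq> (*v) ?A ` U"
    by (rule subset_image_derivative[OF U(2-4) U0 f(2) V(1,3,2) f(3)])
  have AW: "(*v) ?A ` U \<subseteq> W"
    using f(1) by (intro image_derivative_subset[OF U(2) U0 f(2) W(1,3,2)]) (auto simp: inj_holomorphic_maps_def)
  obtain e where e: "0 < e" "cball 0 e \<subseteq> V"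
    using V(1) balanced_zero[OF V(2,4)] open_contains_cball by blast
  have lin: "linear ((*v) ?A)"
    by (rule bounded_linear.linear[OF matrix_vector_mul_bounded_linear])
  have "y \<in> range ((*v) ?A)" for y
  proof -
    define s where "s = e / (norm y + 1)"
    have ny: "0 < norm y + 1"
      by (simp add: add_nonneg_pos)
    have s: "0 < s"
      using e(1) ny by (simp add: s_def)
    have "norm (s *\<^sub>R y) \<le> e"
      using e(1) ny by (simp add: s_def divide_le_eq mult_left_mono)
    then have "s *\<^sub>R y \<in> V"
      using e(2) by auto
    then obtain x where "s *\<^sub>R y = ?A *v x"
      using VA by blast
    then have "?A *v ((1 / s) *\<^sub>R x) = y"
      using s by (metis lin linear_cmul scaleR_scaleR nonzero_divide_eq_eq less_irrefl scaleR_one)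
    then show ?thesis by blast
  qed
  then have "\<exists>B. ?A ** B = mat 1"
    unfolding matrix_right_invertible_surjective by blast
  then have "invertible ?A"
    using invertible_right_inverse by blast
  then show ?thesis
    using VA AW that by blast
qed

section \<open>Comparison of the two extremal problems\<close>

lemma scaled_linear_inj_holomorphic_map:
  fixes A :: "complex ^ 'n ^ 'n"
  assumes "invertible A" "r \<noteq> 0" "(\<lambda>x. r *\<^sub>R (A *v x)) ` U \<subseteq> W"
  shows "(\<lambda>x. r *\<^sub>R (A *v x)) \<in> inj_holomorphic_maps U W"
proof -
  have "inj ((*v) A)"
    using assms(1) invertible_left_inverse matrix_left_invertible_injective by blast
  then have "inj_on (\<lambda>x. r *\<^sub>R (A *v x)) U"
    using assms(2) by (auto simp: inj_on_def)
  moreover have "holomorphic_map_on (\<lambda>x. r *\<^sub>R (A *v x)) U"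
    unfolding holomorphic_map_on_def
  proof (intro ballI exI conjI allI)
    show "((\<lambda>x. r *\<^sub>R (A *v x)) has_derivative (\<lambda>x. r *\<^sub>R (A *v x))) (at z within U)" for z
      by (rule has_derivative_scaleR_right[OF bounded_linear_imp_has_derivative[OF
          matrix_vector_mul_bounded_linear]])
    show "r *\<^sub>R (A *v (c *s v)) = c *s (r *\<^sub>R (A *v v))" for c v
      by (simp only: vector_scalar_commute scaleR_scalar_mult_commute)
  qed
  ultimately show ?thesis
    using assms(3) by (simp add: inj_holomorphic_maps_def)
qed

lemma tanh_real_surj:
  fixes x :: real
  assumes "0 < x" "x < 1"
  obtains r where "0 < r" "tanh r = x"
proof -
  have "((tanh :: real \<Rightarrow> real) \<longlongrightarrow> 1) at_top"
    by (rule tanh_real_at_top)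
  then have "\<forall>\<^sub>F b in at_top. x < tanh b"
    using order_tendstoD(1) assms(2) by blast
  then obtain b where b: "0 \<le> b" "x < tanh b"
    by (metis eventually_at_top_linorder linear)
  then have "\<exists>r\<ge>0. r \<le> b \<and> tanh r = x"
    using assms by (intro IVT') (auto intro!: continuous_intros)
  then show ?thesis
    using that assms(1) by (metis less_irrefl order_le_less tanh_0)
qed

theorem theorem3:
  fixes D :: "(complex ^ 'n) set"
  assumes "is_domain D" and "bounded D" and "balanced D" and "convex D"
  shows "squeezing_fridman_quotient D 0 = 1"
proof -
  let ?B = "ball 0 1 :: (complex ^ 'n) set"
  define S where "S = {r. r > 0 \<and>
     (\<exists>f \<in> inj_holomorphic_maps D ?B. f 0 = 0 \<and> ball 0 r \<subseteq> f ` D)}"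
  define E where "E = {tanh r | r. r > 0 \<and>
     (\<exists>f \<in> inj_holomorphic_maps ?B D. f 0 = 0 \<and> kobayashi_ball D 0 r \<subseteq> f ` ?B)}"
  have D: "open D" "D \<noteq> {}"
    using assms(1) by (auto simp: is_domain_def)
  have D0: "0 \<in> D"
    by (rule balanced_zero[OF assms(3) D(2)])
  have lin: "linear ((*v) A)" for A :: "complex ^ 'n ^ 'n"
    by (rule bounded_linear.linear[OF matrix_vector_mul_bounded_linear])
  have scale: "A *v (r *\<^sub>R x) = r *\<^sub>R (A *v x)" for A :: "complex ^ 'n ^ 'n" and r x
    by (rule linear_cmul[OF lin])
  have inverse: "\<exists>C. invertible C \<and> (\<forall>x. C *v (A *v x) = x) \<and> (\<forall>x. A *v (C *v x) = x)"
    if "invertible A" for A :: "complex ^ 'n ^ 'n"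
    using that unfolding invertible_def by (metis matrix_vector_mul_assoc matrix_vector_mul_lid)
  have S_linear: "\<exists>A. invertible A \<and> ball 0 r \<subseteq> (*v) A ` D \<and> (*v) A ` D \<subseteq> ?B" if r: "r \<in> S" for r
  proof -
    obtain f where f: "f \<in> inj_holomorphic_maps D ?B" "f 0 = 0" "ball 0 r \<subseteq> f ` D" and "0 < r"
      using r by (auto simp: S_def)
    have "ball 0 r \<noteq> ({} :: (complex ^ 'n) set)"
      using \<open>0 < r\<close> by simp
    then obtain A where "invertible A" "ball 0 r \<subseteq> (*v) A ` D" "(*v) A ` D \<subseteq> ?B"
      by (rule linearization[OF f D(1) assms(3,4,2) open_ball balanced_ball convex_ball _
          open_ball balanced_ball convex_ball])
    then show ?thesis
      by (intro exI conjI)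
  qed
  have E_in_S: "E \<subseteq> S"
  proof
    fix \<rho> assume "\<rho> \<in> E"
    then obtain r f where r: "\<rho> = tanh r" "0 < r"
      and f: "f \<in> inj_holomorphic_maps ?B D" "f 0 = 0" "kobayashi_ball D 0 r \<subseteq> f ` ?B"
      by (auto simp: E_def)
    have \<rho>: "0 < \<rho>"
      using r by simp
    \<comment> \<open>This open balanced convex set lies in the Kobayashi ball, so \<open>f\<close>
      covers it, and it can serve as \<open>V\<close> in \<open>linearization\<close>.\<close>
    let ?V = "(*\<^sub>R) \<rho> ` D"
    have V: "?V \<subseteq> f ` ?B"
      using scaling_subset_kobayashi_ball[OF D(1) assms(3) r(2)] f(3) r(1) by simp
    have "open ?V"
      using open_scaling[OF _ D(1), of \<rho>] \<rho> by simp
    then obtain A where A: "invertible A" "?V \<subseteq> (*v) A ` ?B" "(*v) A ` ?B \<subseteq> D"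
      by (rule linearization[OF f(1,2) V open_ball balanced_ball convex_ball bounded_ball _
          balanced_scaling[OF assms(3)] convex_scaling[OF assms(4)] _ D(1) assms(3,4)])
        (use D(2) in simp)
    obtain C where C: "invertible C" "\<And>x. C *v (A *v x) = x" "\<And>x. A *v (C *v x) = x"
      using inverse[OF A(1)] by blast
    \<comment> \<open>Under \<open>\<rho>\<close> times the inverse of \<open>A\<close> the two
      inclusions exchange roles: that of \<open>?V\<close> in the image of the ball bounds the new
      map on \<open>D\<close>, that of this image in \<open>D\<close> makes the new map cover the
      ball of radius \<open>\<rho>\<close>.\<close>
    have "(\<lambda>x. \<rho> *\<^sub>R (C *v x)) \<in> inj_holomorphic_maps D ?B"
    proof (rule scaled_linear_inj_holomorphic_map[OF C(1)])
      show "(\<lambda>x. \<rho> *\<^sub>R (C *v x)) ` D \<subseteq> ?B"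
      proof (rule image_subsetI)
        fix x assume "x \<in> D"
        then obtain b where "b \<in> ?B" "\<rho> *\<^sub>R x = A *v b"
          using A(2) by blast
        then show "\<rho> *\<^sub>R (C *v x) \<in> ?B"
          unfolding scale[symmetric] by (simp only: C(2))
      qed
    qed (use \<rho> in simp)
    moreover have "ball 0 \<rho> \<subseteq> (\<lambda>x. \<rho> *\<^sub>R (C *v x)) ` D"
    proof
      fix y :: "complex ^ 'n" assume "y \<in> ball 0 \<rho>"
      then have "(1 / \<rho>) *\<^sub>R y \<in> ?B"
        using \<rho> by simp
      then have "A *v ((1 / \<rho>) *\<^sub>R y) \<in> D"
        using A(3) by blast
      then show "y \<in> (\<lambda>x. \<rho> *\<^sub>R (C *v x)) ` D"
        by (rule rev_image_eqI) (use \<rho> in \<open>simp add: C(2)\<close>)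
    qed
    ultimately show "\<rho> \<in> S"
      unfolding S_def using \<rho> by (auto intro!: bexI[of _ "\<lambda>x. \<rho> *\<^sub>R (C *v x)"] simp: linear_0[OF lin])
  qed
  have S_le: "\<rho> \<le> 1" if "\<rho> \<in> S" for \<rho>
  proof -
    have "ball 0 \<rho> \<subseteq> ?B"
      using S_linear[OF that] by blast
    then show ?thesis
      by (auto simp: ball_subset_ball_iff)
  qed
  \<comment> \<open>The slack between \<open>\<rho>'\<close> and \<open>\<rho>\<close> is what puts
    the Kobayashi ball with \<open>tanh r = \<rho>'\<close> inside \<open>D\<close> scaled by
    \<open>\<rho>\<close>.\<close>
  have S_in_E: "\<rho>' \<in> E" if \<rho>: "\<rho> \<in> S" "0 < \<rho>'" "\<rho>' < \<rho>" for \<rho> \<rho>'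
  proof -
    have "\<rho>' < 1"
      using S_le[OF \<rho>(1)] \<rho>(3) by simp
    then obtain r where r: "0 < r" "tanh r = \<rho>'"
      using tanh_real_surj \<rho>(2) by blast
    obtain A where A: "invertible A" "ball 0 \<rho> \<subseteq> (*v) A ` D" "(*v) A ` D \<subseteq> ?B"
      using S_linear[OF \<rho>(1)] by blast
    obtain C where C: "invertible C" "\<And>x. C *v (A *v x) = x" "\<And>x. A *v (C *v x) = x"
      using inverse[OF A(1)] by blast
    \<comment> \<open>The same exchange in the other direction: the first inclusion for
      \<open>A\<close> places the image of \<open>?f\<close> in \<open>D\<close>, the second makes
      it contain \<open>D\<close> scaled by \<open>\<rho>\<close>.\<close>
    let ?f = "\<lambda>x. \<rho> *\<^sub>R (C *v x)"
    have "?f \<in> inj_holomorphic_maps ?B D"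
    proof (rule scaled_linear_inj_holomorphic_map[OF C(1)])
      show "?f ` ?B \<subseteq> D"
      proof (rule image_subsetI)
        fix x assume "x \<in> ?B"
        then have "\<rho> *\<^sub>R x \<in> ball 0 \<rho>"
          using \<rho> by simp
        then obtain d where "d \<in> D" "\<rho> *\<^sub>R x = A *v d"
          using A(2) by blast
        then show "?f x \<in> D"
          unfolding scale[symmetric] by (simp only: C(2))
      qed
    qed (use \<rho> in simp)
    moreover have "kobayashi_ball D 0 r \<subseteq> ?f ` ?B"
    proof -
      have "kobayashi_ball D 0 r \<subseteq> (*\<^sub>R) \<rho> ` D"
        using kobayashi_ball_subset_scaling[OF D(1) assms(3,4) r(1)] r(2) \<rho>(3) by simp
      also have "\<dots> \<subseteq> ?f ` ?B"
      proof (rule image_subsetI)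
        fix d assume "d \<in> D"
        then have "A *v d \<in> ?B"
          using A(3) by blast
        then show "\<rho> *\<^sub>R d \<in> ?f ` ?B"
          by (rule rev_image_eqI) (simp add: C(2))
      qed
      finally show ?thesis .
    qed
    ultimately show ?thesis
      unfolding E_def using r
      by (auto intro!: exI[of _ r] bexI[of _ ?f] simp: linear_0[OF lin])
  qed
  have "S \<noteq> {}"
  proof -
    obtain e where e: "0 < e" "ball 0 e \<subseteq> D"
      using D(1) D0 open_contains_ball by blast
    obtain M where M: "0 < M" "\<And>x. x \<in> D \<Longrightarrow> norm x < M"
      using assms(2) bounded_pos_less by blast
    have inv1: "invertible (mat 1 :: complex ^ 'n ^ 'n)"
      by (simp add: invertible_det_nz)
    \<comment> \<open>A homothety shrinking \<open>D\<close> into the unit ball serves as a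
      competitor.\<close>
    let ?f = "\<lambda>x. (1 / M) *\<^sub>R ((mat 1 :: complex ^ 'n ^ 'n) *v x)"
    have "?f \<in> inj_holomorphic_maps D ?B"
      by (rule scaled_linear_inj_holomorphic_map[OF inv1]) (use M in auto)
    moreover have "ball 0 (e / M) \<subseteq> ?f ` D"
    proof
      fix y :: "complex ^ 'n" assume "y \<in> ball 0 (e / M)"
      then have "M *\<^sub>R y \<in> ball 0 e"
        using M(1) by (simp add: less_divide_eq mult.commute)
      then have "M *\<^sub>R y \<in> D"
        using e(2) by blast
      then show "y \<in> ?f ` D"
        by (rule rev_image_eqI) (use M(1) in simp)
    qed
    ultimately have "e / M \<in> S"
      unfolding S_def using e(1) M(1) by (auto intro!: bexI[of _ ?f])
    then show ?thesis by blast
  qed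
  then obtain \<rho>0 where \<rho>0: "\<rho>0 \<in> S" "0 < \<rho>0"
    by (auto simp: S_def)
  then have "\<rho>0 / 2 \<in> E"
    by (intro S_in_E[OF \<rho>0(1)]) auto
  have bddS: "bdd_above S"
    using S_le by (rule bdd_aboveI)
  then have bddE: "bdd_above E"
    by (rule bdd_above_mono[OF _ E_in_S])
  have "Sup E \<le> Sup S"
    using \<open>\<rho>0 / 2 \<in> E\<close> bddS E_in_S by (intro cSup_subset_mono) auto
  \<comment> \<open>Every positive number below an element of \<open>S\<close> lies in
    \<open>E\<close>, so the slack lost in \<open>S_in_E\<close> does not affect the
    supremum.\<close>
  moreover have "Sup S \<le> Sup E"
  proof (rule cSup_least[OF \<open>S \<noteq> {}\<close>])
    fix \<rho> assume \<rho>: "\<rho> \<in> S"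
    show "\<rho> \<le> Sup E"
    proof (rule dense_le_bounded)
      show "0 < \<rho>"
        using \<rho> by (simp add: S_def)
      show "\<rho>' \<le> Sup E" if "0 < \<rho>'" "\<rho>' < \<rho>" for \<rho>'
        using S_in_E[OF \<rho> that] bddE by (rule cSup_upper)
    qed
  qed
  moreover have "0 < Sup S"
    using \<rho>0 cSup_upper[OF _ bddS] by force
  ultimately show ?thesis
    unfolding squeezing_fridman_quotient_def squeezing_function_def fridman_invariant_def
      S_def[symmetric] E_def[symmetric]
    by simp
qed

end
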